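(* Let $d\ge 2$ be a fixed integer and let $p=p_n\in(0,1)$ satisfy $p_n(1-p_n)\gg \frac{\log^4 n}{n^{d-1}}$. Let $H$ be the random $d$-uniform hypergraph $H(n,p_n)$ on $V=\{1,\dots,n\}$, conditioned to be connected, and for $j\in V$ let $H_j=\sum_{i\in V}\pi(i)H_{ij}$ be the average target hitting time of $j$ for simple random walk on $H$. Then asymptotically almost surely $$H_j=n(1+o(1)),$$ i.e. for every $\varepsilon>0$ and every choice of vertices $j=j_n\in\{1,\dots,n\}$, the probability (over the random hypergraph) that $(1-\varepsilon)n\le H_j\le(1+\varepsilon)n$ tends to $1$ as $n\to\infty$.
   Context: Notation: $a_n\gg b_n$ means $b_n/a_n\to0$ as $n\to\infty$. The random $d$-uniform hypergraph $H(n,p)$ has vertex set $V=\{1,\dots,n\}$, and each $d$-element subset of $V$ is included in the (hyper)edge set $E$ independently with probability $p$. All probabilities are understood conditionally on the event that $H$ is connected (any two vertices are joined by a chain of successively intersecting hyperedges). Simple random walk on $H$: if the walk is at vertex $v$ at time $t$, it chooses uniformly a hyperedge $e\in E$ with $v\in e$, and then moves at time $t+1$ to a vertex $w\in e\setminus\{v\}$ chosen uniformly (probability $\frac1{d-1}$ each). Equivalently, it is simple random walk on the multigraph in which $v\ne w$ are joined by $k$ edges if exactly $k$ hyperedges contain both. Let $d_i=(d-1)\,|\{e\in E: i\in e\}|$ be the degree of $i$ in this multigraph. The invariant probability measure is $\pi(i)=d_i/\sum_{j\in V}d_j$. $H_{ij}$ denotes the expected time (in the random walk measure, for a fixed realization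 of the hypergraph) for the walk started at $i$ to reach $j$, with $H_{jj}=0$. Thus $H_j$ is a random variable with respect to the random hypergraph. *)

theory Defs
  imports "HOL-Probability.Probability"
begin

section \<open>Random uniform hypergraphs\<close>

text \<open>A hypergraph on the vertex set \<open>{1..n}\<close> is represented by its set of hyperedges.\<close>

definition hyperedges :: "nat \<Rightarrow> nat \<Rightarrow> nat set set" where
  "hyperedges d n = {e. e \<subseteq> {1..n} \<and> card e = d}"

definition random_hypergraph :: "nat \<Rightarrow> nat \<Rightarrow> real \<Rightarrow> nat set set pmf" where
  "random_hypergraph d n p =
     map_pmf (\<lambda>f. {e \<in> hyperedges d n. f e})
       (Pi_pmf (hyperedges d n) False (\<lambda>_. bernoulli_pmf p))"

definition connected_hypergraph :: "nat \<Rightarrow> nat set set \<Rightarrow> bool" where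
  "connected_hypergraph n E \<longleftrightarrow>
     (\<forall>u\<in>{1..n}. \<forall>v\<in>{1..n}. u \<noteq> v \<longrightarrow>
        (\<exists>es. es \<noteq> [] \<and> set es \<subseteq> E \<and> u \<in> hd es \<and> v \<in> last es \<and>
              successively (\<lambda>e e'. e \<inter> e' \<noteq> {}) es))"

section \<open>Simple random walk\<close>

text \<open>
  At a vertex contained in no hyperedge the step distribution is unspecified; this does not occur
  for a connected hypergraph with at least two vertices.
\<close>

definition step_pmf :: "nat set set \<Rightarrow> nat \<Rightarrow> nat pmf" where
  "step_pmf E v = bind_pmf (pmf_of_set {e \<in> E. v \<in> e}) (\<lambda>e. pmf_of_set (e - {v}))"

text \<open>
  The conditional law of the position at time \<open>t\<close>, given the trajectory \<open>\<omega>\<close> at the times before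
  \<open>t\<close>, for the walk started at \<open>i\<close>. The law of the whole trajectory is obtained from these kernels
  by the Ionescu-Tulcea theorem.
\<close>

definition walk_kernel ::
  "nat set set \<Rightarrow> nat \<Rightarrow> nat \<Rightarrow> (nat \<Rightarrow> nat) \<Rightarrow> nat measure" where
  "walk_kernel E i t \<omega> =
     measure_pmf (case t of 0 \<Rightarrow> return_pmf i | Suc s \<Rightarrow> step_pmf E (\<omega> s))"

lemma walk_kernel_measurable:
  "walk_kernel E i t \<in>
     measurable (PiM {0..<t} (\<lambda>_. count_space UNIV)) (subprob_algebra (count_space UNIV))"
proof (cases t)
  case 0
  then show ?thesis
    by (auto simp: walk_kernel_def[abs_def] space_subprob_algebra
          intro!: measurable_const prob_space_imp_subprob_space measure_pmf.prob_space_axioms)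
next
  case (Suc s)
  have k: "(\<lambda>v. measure_pmf (step_pmf E v)) \<in>
      measurable (count_space UNIV) (subprob_algebra (count_space UNIV))"
    by (auto simp: space_subprob_algebra
          intro!: prob_space_imp_subprob_space measure_pmf.prob_space_axioms)
  have "(\<lambda>\<omega>. \<omega> s) \<in> measurable (PiM {0..<t} (\<lambda>_. count_space UNIV)) (count_space (UNIV::nat set))"
    using Suc by (intro measurable_component_singleton) auto
  from measurable_compose[OF this k] show ?thesis
    using Suc by (simp add: walk_kernel_def[abs_def])
qed

lemma prob_space_walk_kernel: "prob_space (walk_kernel E i t \<omega>)"
  unfolding walk_kernel_def by (rule measure_pmf.prob_space_axioms)

interpretation walk: Ionescu_Tulcea "walk_kernel E i" "\<lambda>_. count_space UNIV" for E i
  by (rule Ionescu_Tulcea.intro) (rule walk_kernel_measurable prob_space_walk_kernel)+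

definition walk_measure :: "nat set set \<Rightarrow> nat \<Rightarrow> (nat \<Rightarrow> nat) measure" where
  "walk_measure E i = walk.PF.lim E i"

lemma prob_space_walk_measure: "prob_space (walk_measure E i)"
proof
  have "emeasure (walk_measure E i) (space (walk_measure E i)) =
      emeasure (walk.CI E i {}) (space (PiM {} (\<lambda>_. count_space UNIV)))"
    using walk.lim[of "{}" "space (PiM {} (\<lambda>_. count_space UNIV))" E i]
    by (simp add: walk_measure_def prod_emb_def space_PiM restrict_def sets_PiM_empty)
  also have "\<dots> = 1"
    using prob_space.emeasure_space_1[OF walk.PF.prob_space_P[of "{}" E i]]
    by (simp add: walk.PF.space_P)
  finally show "emeasure (walk_measure E i) (space (walk_measure E i)) = 1" .
qed

lemma sets_walk_measure [measurable_cong]: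
  "sets (walk_measure E i) = sets (PiM UNIV (\<lambda>_. count_space UNIV))"
  by (simp add: walk_measure_def)

section \<open>Hitting times\<close>

text \<open>The infimum over the empty set is \<open>\<infinity>\<close>.\<close>

definition hitting_time :: "nat \<Rightarrow> (nat \<Rightarrow> nat) \<Rightarrow> ennreal" where
  "hitting_time j \<omega> = (INF t\<in>{t. \<omega> t = j}. of_nat t)"

lemma measurable_hitting_time [measurable]:
  "hitting_time j \<in> borel_measurable (PiM UNIV (\<lambda>_. count_space UNIV))"
proof -
  have *: "hitting_time j = (\<lambda>\<omega>. INF t. if \<omega> t = j then of_nat t else top)"
  proof (intro ext antisym)
    fix \<omega>
    show "hitting_time j \<omega> \<le> (INF t. if \<omega> t = j then of_nat t else top)"
      unfolding hitting_time_def by (intro INF_greatest) (auto intro: INF_lower)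
    show "(INF t. if \<omega> t = j then of_nat t else top) \<le> hitting_time j \<omega>"
      unfolding hitting_time_def
    proof (intro INF_greatest)
      fix t assume "t \<in> {t. \<omega> t = j}"
      then show "(INF t. if \<omega> t = j then of_nat t else top) \<le> (of_nat t :: ennreal)"
        by (intro INF_lower2[of t]) auto
    qed
  qed
  show ?thesis
    unfolding * by measurable
qed

definition expected_hitting_time :: "nat set set \<Rightarrow> nat \<Rightarrow> nat \<Rightarrow> ennreal" where
  "expected_hitting_time E i j = (\<integral>\<^sup>+\<omega>. hitting_time j \<omega> \<partial>walk_measure E i)"

definition walk_degree :: "nat \<Rightarrow> nat set set \<Rightarrow> nat \<Rightarrow> nat" where
  "walk_degree d E i = (d - 1) * card {e \<in> E. i \<in> e}"

definition invariant_prob :: "nat \<Rightarrow> nat \<Rightarrow> nat set set \<Rightarrow> nat \<Rightarrow> real" where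
  "invariant_prob d n E i = real (walk_degree d E i) / (\<Sum>k=1..n. real (walk_degree d E k))"

definition average_target_hitting_time :: "nat \<Rightarrow> nat \<Rightarrow> nat set set \<Rightarrow> nat \<Rightarrow> ennreal" where
  "average_target_hitting_time d n E j =
     (\<Sum>i=1..n. ennreal (invariant_prob d n E i) * expected_hitting_time E i j)"

end

theory Submission
  imports Defs "HOL-Real_Asymp.Real_Asymp"
begin

text \<open>
  The simple random walk is the walk on a weighted graph in which the weight \<open>c i k\<close> is the number of
  hyperedges containing both \<open>i\<close> and \<open>k\<close>. Write \<open>deg\<close> for the weighted degree, \<open>vol\<close> for the sum of the
  degrees, \<open>L\<close> for the Laplacian and \<open>\<E> f = \<Sum>i. f i * L f i\<close> for the Dirichlet energy. The hitting
  times \<open>h\<close> of \<open>j\<close> solve \<open>L h = deg\<close> away from \<open>j\<close>, and the self-adjointness of \<open>L\<close> gives the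
  identity \<open>mean_hitting_identity\<close>

    \<open>H\<^sub>j = vol / deg j - 2 + \<E> v / vol\<close>,

  where \<open>L v = deg \<cdot> \<psi>\<close> and \<open>1 + \<psi>\<close> is the density, with respect to the invariant measure, of the
  position one step after \<open>j\<close>. Since \<open>\<E> v\<close> is nonnegative, this contains the lower bound. For the upper
  bound let \<open>g\<close> be the spectral gap. Then \<open>\<E> v\<close> is at most \<open>1 / g\<close> times the squared norm of \<open>\<psi>\<close>, and
  this squared norm is controlled by the probability of returning to \<open>j\<close> in two steps. If that
  probability tends to \<open>0\<close> while the gap is bounded from below, then \<open>H\<^sub>j\<close> is asymptotic to
  \<open>vol / deg j\<close> (\<open>mean_hitting_upper\<close>).

  The gap comes from edge expansion through Cheeger's inequality (\<open>poincare_of_cut\<close>): Chernoff bounds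
  for the number of hyperedges across a vertex set \<open>S\<close> have failure probability exponentially small in
  \<open>|S|\<close> times the mean degree \<open>D\<close>, and this beats the number of sets \<open>S\<close> as soon as \<open>D\<close> is much larger
  than \<open>log n\<close>. The same expansion makes the hypergraph connected, so that conditioning on connectedness
  costs nothing. Chernoff bounds also show that the degrees are at most \<open>2 D\<close>, that the codegrees with
  \<open>j\<close> are \<open>o(D)\<close>, which bounds the two-step return probability, and that the degree of \<open>j\<close> and the
  total number of edges are close to their means, so that \<open>vol / deg j\<close> is close to \<open>n\<close>. These
  properties are collected in \<open>regular\<close>; \<open>regular_implies\<close> is the deterministic half of the proof and
  \<open>prob_regular_ge\<close> the probabilistic one.

  The expected hitting times are defined as integrals over trajectories and could be infinite a priori.
  They are sums of the probabilities that the walk avoids \<open>j\<close> up to time \<open>t\<close>, and their truncations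
  are finite and satisfy \<open>L x \<le> deg\<close> away from \<open>j\<close>. The gap bounds every such \<open>x\<close> by the same constant
  (\<open>sum_subsolution_le\<close>), hence the hitting times are finite.
\<close>

section \<open>Hitting times and Dirichlet energy on a weighted graph\<close>

lemma sqrt_mult_sqrt:
  assumes "0 \<le> (a::real)"
  shows "(sqrt a * x) * (sqrt a * y) = a * (x * y)"
proof -
  have "(sqrt a * x) * (sqrt a * y) = (sqrt a * sqrt a) * (x * y)" by (simp only: mult_ac)
  then show ?thesis using assms by simp
qed

locale weighted_graph =
  fixes V :: "'a set" and c :: "'a \<Rightarrow> 'a \<Rightarrow> real"
  assumes finite_V: "finite V"
    and c_sym: "c i k = c k i"
    and c_nonneg: "0 \<le> c i k"
    and c_irrefl: "c i i = 0"
begin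

definition deg :: "'a \<Rightarrow> real" where
  "deg i = (\<Sum>k\<in>V. c i k)"

definition vol :: real where
  "vol = (\<Sum>i\<in>V. deg i)"

definition laplacian :: "('a \<Rightarrow> real) \<Rightarrow> 'a \<Rightarrow> real" where
  "laplacian f i = deg i * f i - (\<Sum>k\<in>V. c i k * f k)"

definition energy :: "('a \<Rightarrow> real) \<Rightarrow> real" where
  "energy f = (\<Sum>i\<in>V. f i * laplacian f i)"

lemma deg_nonneg: "0 \<le> deg i"
  unfolding deg_def by (intro sum_nonneg c_nonneg)

lemma vol_nonneg: "0 \<le> vol"
  unfolding vol_def by (intro sum_nonneg deg_nonneg)

lemma vol_pos:
  assumes "j \<in> V" "0 < deg j"
  shows "0 < vol"
  unfolding vol_def using assms finite_V deg_nonneg by (intro sum_pos2[of V j]) auto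

lemma deg_eq_sum_in: "deg i = (\<Sum>k\<in>V. c k i)"
  unfolding deg_def by (simp add: c_sym)

lemma laplacian_symmetric:
  "(\<Sum>i\<in>V. f i * laplacian g i) = (\<Sum>i\<in>V. g i * laplacian f i)"
proof -
  have "(\<Sum>i\<in>V. \<Sum>k\<in>V. f i * (c i k * g k)) = (\<Sum>i\<in>V. \<Sum>k\<in>V. g i * (c i k * f k))"
    by (subst sum.swap) (simp add: c_sym mult_ac)
  then show ?thesis
    unfolding laplacian_def
    by (simp add: right_diff_distrib sum_subtractf sum_distrib_left mult_ac)
qed

lemma laplacian_const [simp]: "laplacian (\<lambda>_. a) i = 0"
  unfolding laplacian_def deg_def by (simp add: sum_distrib_right)

lemma sum_laplacian: "(\<Sum>i\<in>V. laplacian f i) = 0"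
  using laplacian_symmetric[of "\<lambda>_. 1" f] by simp

lemma laplacian_diff: "laplacian (\<lambda>i. f i - g i) i = laplacian f i - laplacian g i"
  unfolding laplacian_def by (simp add: right_diff_distrib sum_subtractf)

lemma energy_eq: "energy f = (\<Sum>i\<in>V. \<Sum>k\<in>V. c i k * (f i - f k)\<^sup>2) / 2"
proof -
  have 1: "(\<Sum>i\<in>V. \<Sum>k\<in>V. c i k * (f i)\<^sup>2) = (\<Sum>i\<in>V. deg i * (f i)\<^sup>2)"
    unfolding deg_def by (simp add: sum_distrib_right)
  have "(\<Sum>i\<in>V. \<Sum>k\<in>V. c i k * (f k)\<^sup>2) = (\<Sum>i\<in>V. \<Sum>k\<in>V. c i k * (f i)\<^sup>2)"
    by (subst sum.swap) (simp add: c_sym)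
  with 1 have 2: "(\<Sum>i\<in>V. \<Sum>k\<in>V. c i k * (f k)\<^sup>2) = (\<Sum>i\<in>V. deg i * (f i)\<^sup>2)" by simp
  have "(\<Sum>i\<in>V. \<Sum>k\<in>V. c i k * (f i - f k)\<^sup>2)
      = (\<Sum>i\<in>V. \<Sum>k\<in>V. c i k * (f i)\<^sup>2) + (\<Sum>i\<in>V. \<Sum>k\<in>V. c i k * (f k)\<^sup>2)
        - 2 * (\<Sum>i\<in>V. \<Sum>k\<in>V. f i * (c i k * f k))"
    by (simp add: power2_diff algebra_simps sum.distrib sum_subtractf sum_distrib_left)
  also have "\<dots> = 2 * energy f"
    unfolding 1 2 energy_def laplacian_def
    by (simp add: right_diff_distrib sum_subtractf sum_distrib_left power2_eq_square mult_ac)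
  finally show ?thesis by simp
qed

lemma energy_nonneg: "0 \<le> energy f"
  unfolding energy_eq by (intro divide_nonneg_nonneg sum_nonneg mult_nonneg_nonneg c_nonneg) auto

lemma energy_shift: "energy (\<lambda>i. f i - a) = energy f"
  by (simp add: energy_eq)

definition mean_hitting :: "('a \<Rightarrow> real) \<Rightarrow> real" where
  "mean_hitting h = (\<Sum>i\<in>V. deg i * h i) / vol"

context
  fixes h :: "'a \<Rightarrow> real" and j :: 'a
  assumes j: "j \<in> V" and deg_pos: "\<And>i. i \<in> V \<Longrightarrow> 0 < deg i"
    and hitting_self: "h j = 0"
    and hitting_step: "\<And>i. i \<in> V \<Longrightarrow> i \<noteq> j \<Longrightarrow> laplacian h i = deg i"
begin

text \<open>
  The density of the point mass at \<open>j\<close> with respect to the invariant measure, centred to have mean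
  zero. The step density below is its image under one step of the walk.
\<close>

definition point_density :: "'a \<Rightarrow> real" where
  "point_density i = (if i = j then vol / deg j else 0) - 1"

definition step_density :: "'a \<Rightarrow> real" where
  "step_density i = c i j * vol / (deg i * deg j) - 1"

text \<open>
  The centred potential \<open>mean_hitting h - h\<close> has the point density as its leading term; the corrector is
  the rest.
\<close>

definition corrector :: "'a \<Rightarrow> real" where
  "corrector i = mean_hitting h - h i - point_density i"

text \<open>
  A Laplacian sums to zero over all vertices, so its value at the target is forced by the values
  elsewhere.
\<close>

lemma laplacian_hitting:
  assumes "i \<in> V"
  shows "laplacian h i = deg i - (if i = j then vol else 0)"
proof (cases "i = j")
  case True
  have "0 = laplacian h j + (\<Sum>i\<in>V - {j}. laplacian h i)"
    using sum_laplacian[of h] j finite_V by (simp add: sum.remove)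
  also have "(\<Sum>i\<in>V - {j}. laplacian h i) = (\<Sum>i\<in>V - {j}. deg i)"
    using hitting_step by (intro sum.cong) auto
  also have "\<dots> = vol - deg j"
    unfolding vol_def using j finite_V by (simp add: sum.remove)
  finally show ?thesis using True by simp
qed (use assms hitting_step in auto)

lemma vol_gt_0: "0 < vol"
  using vol_pos[OF j] deg_pos[OF j] by simp

lemma sum_point: "(\<Sum>i\<in>V. f i * (if i = j then a else 0)) = f j * (a::real)"
  using j finite_V by (simp add: if_distrib cong: if_cong)

lemma deg_point_density: "i \<in> V \<Longrightarrow> deg i * point_density i = (if i = j then vol else 0) - deg i"
  using deg_pos[of i] by (auto simp: point_density_def field_simps)

lemma deg_step_density:
  assumes "i \<in> V"
  shows "deg i * step_density i = (\<Sum>k\<in>V. c i k * point_density k)"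
proof -
  have "(\<Sum>k\<in>V. c i k * point_density k) = c i j * (vol / deg j) - deg i"
    unfolding point_density_def right_diff_distrib sum_subtractf sum_point by (simp add: deg_def)
  then show ?thesis
    using deg_pos[OF assms] deg_pos[OF j] by (simp add: step_density_def right_diff_distrib)
qed

lemma laplacian_corrector:
  assumes "i \<in> V"
  shows "laplacian corrector i = deg i * step_density i"
proof -
  have "laplacian corrector i
      = laplacian (\<lambda>_. mean_hitting h) i - laplacian h i - laplacian point_density i"
    unfolding corrector_def[abs_def] by (simp only: laplacian_diff)
  also have "\<dots> = - laplacian h i - deg i * point_density i + deg i * step_density i"
    unfolding deg_step_density[OF assms] by (simp add: laplacian_def[of point_density])
  also have "\<dots> = deg i * step_density i"
    using assms by (simp add: laplacian_hitting deg_point_density)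
  finally show ?thesis .
qed

lemma sum_deg_point_density: "(\<Sum>i\<in>V. deg i * point_density i) = 0"
  using j finite_V by (simp add: deg_point_density sum_subtractf vol_def)

lemma sum_deg_step_density: "(\<Sum>i\<in>V. deg i * step_density i) = 0"
  using sum_laplacian[of corrector] by (simp add: laplacian_corrector)

lemma sum_deg_corrector: "(\<Sum>i\<in>V. deg i * corrector i) = 0"
proof -
  have "(\<Sum>i\<in>V. deg i * corrector i) = vol * mean_hitting h - (\<Sum>i\<in>V. deg i * h i)"
    using sum_deg_point_density
    by (simp add: corrector_def right_diff_distrib sum_subtractf vol_def sum_distrib_right)
  then show ?thesis using vol_gt_0 by (simp add: mean_hitting_def)
qed

lemma energy_corrector: "energy corrector = (\<Sum>i\<in>V. deg i * corrector i * step_density i)"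
  unfolding energy_def by (intro sum.cong) (auto simp: laplacian_corrector)

lemma sum_point_density:
  "(\<Sum>i\<in>V. deg i * f i * point_density i) = vol * f j - (\<Sum>i\<in>V. deg i * f i)"
proof -
  have "(\<Sum>i\<in>V. deg i * f i * point_density i)
      = (\<Sum>i\<in>V. f i * (if i = j then vol else 0) - deg i * f i)"
  proof (intro sum.cong refl)
    fix i assume "i \<in> V"
    have "deg i * f i * point_density i = f i * (deg i * point_density i)" by simp
    also have "\<dots> = f i * (if i = j then vol else 0) - deg i * f i"
      unfolding deg_point_density[OF \<open>i \<in> V\<close>] by (simp add: right_diff_distrib)
    finally show "deg i * f i * point_density i = f i * (if i = j then vol else 0) - deg i * f i" .
  qed
  then show ?thesis by (simp add: sum_subtractf sum_point)
qed

text \<open>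
  The value of the corrector at \<open>j\<close> is \<open>mean_hitting h\<close> up to explicit terms, and it can be computed a
  second time as an inner product. The two units subtracted on the right come from centring the
  point density and the step density at \<open>j\<close>, where the uncentred step density is \<open>0\<close> because the walk
  never stays where it is.
\<close>

theorem mean_hitting_identity:
  "mean_hitting h = vol / deg j - 2 + energy corrector / vol"
proof -
  let ?k = "\<lambda>i. mean_hitting h - h i"
  have Lk: "laplacian ?k i = deg i * point_density i" if "i \<in> V" for i
    using that by (simp add: laplacian_diff laplacian_hitting deg_point_density)
  have k: "?k i = point_density i + corrector i" for i by (simp add: corrector_def)
  have kj: "corrector j = mean_hitting h - vol / deg j + 1"
    by (simp add: corrector_def hitting_self point_density_def)
  \<comment> \<open>Evaluate \<open>v j\<close> by pairing \<open>v\<close> with \<open>L k = deg \<cdot> \<phi>\<close>, then move \<open>L\<close> over to \<open>v\<close>; here \<open>v\<close> is the corrector,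
    \<open>\<phi>\<close> the point density, and \<open>k = \<phi> + v\<close>.\<close>
  have "vol * corrector j = (\<Sum>i\<in>V. deg i * corrector i * point_density i)"
    by (simp add: sum_point_density sum_deg_corrector)
  also have "\<dots> = (\<Sum>i\<in>V. corrector i * laplacian ?k i)"
    by (intro sum.cong) (auto simp: Lk)
  also have "\<dots> = (\<Sum>i\<in>V. ?k i * laplacian corrector i)"
    by (rule laplacian_symmetric)
  also have "\<dots> = (\<Sum>i\<in>V. deg i * step_density i * point_density i + deg i * corrector i * step_density i)"
    unfolding k by (intro sum.cong) (auto simp: laplacian_corrector algebra_simps)
  also have "\<dots> = - vol + energy corrector"
    by (simp add: sum.distrib sum_point_density sum_deg_step_density energy_corrector
        step_density_def[of j] c_irrefl)
  finally show ?thesis unfolding kj using vol_gt_0 by (simp add: field_simps)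
qed

corollary mean_hitting_lower: "vol / deg j - 2 \<le> mean_hitting h"
  using mean_hitting_identity energy_nonneg vol_gt_0 by simp

text \<open>
  Cauchy-Schwarz together with the gap turns \<open>\<E> v = \<langle>v, \<psi>\<rangle>\<close> into \<open>\<E> v \<le> \<parallel>\<psi>\<parallel>\<^sup>2 / g\<close>. The norm of \<open>\<psi>\<close> is
  controlled by the probability of returning to \<open>j\<close> in two steps, and hence by the bound \<open>\<delta>\<close> for the
  probability of the second of these steps.
\<close>

theorem mean_hitting_upper:
  assumes gap: "0 < g" "\<And>f. (\<Sum>i\<in>V. deg i * f i) = 0 \<Longrightarrow> g * (\<Sum>i\<in>V. deg i * (f i)\<^sup>2) \<le> energy f"
    and return: "\<And>i. i \<in> V \<Longrightarrow> c i j \<le> \<delta> * deg i"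
  shows "mean_hitting h \<le> vol / deg j * (1 + \<delta> / g)"
proof -
  define E where "E = energy corrector"
  define \<Psi> where "\<Psi> = (\<Sum>i\<in>V. deg i * (step_density i)\<^sup>2)"
  have \<Psi>: "0 \<le> \<Psi>" unfolding \<Psi>_def by (intro sum_nonneg mult_nonneg_nonneg deg_nonneg) auto
  have "E\<^sup>2 = (\<Sum>i\<in>V. (sqrt (deg i) * corrector i) * (sqrt (deg i) * step_density i))\<^sup>2"
    unfolding E_def energy_corrector by (simp only: sqrt_mult_sqrt[OF deg_nonneg]) (simp only: mult.assoc)
  also have "\<dots> \<le> (\<Sum>i\<in>V. (sqrt (deg i) * corrector i)\<^sup>2) * (\<Sum>i\<in>V. (sqrt (deg i) * step_density i)\<^sup>2)"
    by (rule Cauchy_Schwarz_ineq_sum)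
  also have "\<dots> = (\<Sum>i\<in>V. deg i * (corrector i)\<^sup>2) * \<Psi>"
    by (simp add: \<Psi>_def power_mult_distrib deg_nonneg)
  also have "\<dots> \<le> E / g * \<Psi>"
    using gap(2)[OF sum_deg_corrector] gap(1) \<Psi> by (intro mult_right_mono) (auto simp: E_def field_simps)
  finally have "E * E \<le> E * (\<Psi> / g)" by (simp add: power2_eq_square)
  moreover have "0 \<le> E" unfolding E_def by (rule energy_nonneg)
  ultimately have E: "E \<le> \<Psi> / g"
    using \<Psi> gap(1) mult_left_le_imp_le[of E E "\<Psi> / g"] by (cases "E = 0") auto
  have "\<Psi> = (\<Sum>i\<in>V. (c i j)\<^sup>2 / deg i * (vol / deg j)\<^sup>2 - 2 * (c i j * (vol / deg j)) + deg i)"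
    unfolding \<Psi>_def
  proof (intro sum.cong refl)
    fix i assume "i \<in> V"
    then have p: "0 < deg i" "0 < deg j" using deg_pos j by auto
    define a where "a = vol / deg j"
    have s: "step_density i = c i j * a / deg i - 1" by (simp add: step_density_def a_def)
    show "deg i * (step_density i)\<^sup>2 = (c i j)\<^sup>2 / deg i * (vol / deg j)\<^sup>2 - 2 * (c i j * (vol / deg j)) + deg i"
      unfolding s a_def[symmetric] using p by (simp add: field_simps power2_eq_square)
  qed
  also have "\<dots> = (\<Sum>i\<in>V. (c i j)\<^sup>2 / deg i) * (vol / deg j)\<^sup>2 - 2 * (deg j * (vol / deg j)) + vol"
    by (simp only: sum.distrib sum_subtractf sum_distrib_left[symmetric] sum_distrib_right[symmetric]
        deg_eq_sum_in[symmetric] vol_def[symmetric])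
  also have "\<dots> \<le> (\<Sum>i\<in>V. (c i j)\<^sup>2 / deg i) * (vol / deg j)\<^sup>2"
    using deg_pos[OF j] vol_gt_0 by simp
  also have "\<dots> \<le> (\<Sum>i\<in>V. \<delta> * c i j) * (vol / deg j)\<^sup>2"
  proof (intro mult_right_mono sum_mono)
    fix i assume i: "i \<in> V"
    have "(c i j)\<^sup>2 / deg i = c i j * (c i j / deg i)" by (simp add: power2_eq_square)
    also have "\<dots> \<le> c i j * \<delta>"
      using return[OF i] deg_pos[OF i] by (intro mult_left_mono c_nonneg) (simp add: field_simps)
    finally show "(c i j)\<^sup>2 / deg i \<le> \<delta> * c i j" by (simp add: mult.commute)
  qed simp
  also have "\<dots> = \<delta> * (vol / deg j) * vol"
    using deg_pos[OF j] by (simp add: sum_distrib_left[symmetric] deg_eq_sum_in[symmetric] power2_eq_square)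
  finally have "\<Psi> / g / vol \<le> \<delta> * (vol / deg j) / g"
    using gap(1) vol_gt_0 by (simp add: field_simps)
  moreover have "E / vol \<le> \<Psi> / g / vol"
    using E vol_gt_0 by (intro divide_right_mono) auto
  ultimately have "mean_hitting h \<le> vol / deg j + \<delta> * (vol / deg j) / g"
    using mean_hitting_identity unfolding E_def[symmetric] by linarith
  moreover have "\<delta> * (vol / deg j) / g = vol / deg j * (\<delta> / g)" by simp
  ultimately show ?thesis unfolding distrib_left mult_1_right by linarith
qed

end


section \<open>Cheeger's inequality for the Dirichlet energy\<close>

definition cut :: "'a set \<Rightarrow> real" where
  "cut S = (\<Sum>i\<in>S. \<Sum>k\<in>V - S. c i k)"

lemma cut_complement:
  assumes "S \<subseteq> V"
  shows "cut (V - S) = cut S"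
proof -
  have "V - (V - S) = S" using assms by auto
  then show ?thesis unfolding cut_def by (simp add: c_sym[of _ "_::'a"]) (subst sum.swap, simp add: c_sym)
qed

text \<open>
  A lower bound on all cuts is the same as a comparison of total variations with the complete graph:
  integrating over the threshold \<open>t\<close> the cut of the superlevel set above \<open>t\<close> gives the total variation.
\<close>

lemma cut_comparison:
  fixes f :: "'a \<Rightarrow> real" and \<kappa> :: real
  assumes "\<And>S. S \<subseteq> V \<Longrightarrow> \<kappa> * card S * card (V - S) \<le> cut S"
  shows "\<kappa> * (\<Sum>i\<in>V. \<Sum>k\<in>V. \<bar>f i - f k\<bar>) \<le> (\<Sum>i\<in>V. \<Sum>k\<in>V. c i k * \<bar>f i - f k\<bar>)"
proof -
  define I where "I i k t = (indicator {f k..<f i} t :: real)" for i k t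
  define S where "S t = {i \<in> V. f i > t}" for t
  have int: "integrable lborel (I i k)" for i k
    unfolding I_def by (cases "f k \<le> f i") (auto simp: integrable_indicator_iff)
  have int': "(\<integral>t. I i k t \<partial>lborel) = max 0 (f i - f k)" for i k
    unfolding I_def by (cases "f k \<le> f i") auto
  \<comment> \<open>\<open>\<bar>f i - f k\<bar>\<close> is the sum of the positive parts of \<open>f i - f k\<close> and \<open>f k - f i\<close>, and by symmetry both
    contribute equally to a sum over ordered pairs.\<close>
  have half: "(\<Sum>i\<in>V. \<Sum>k\<in>V. a i k * \<bar>f i - f k\<bar>)
      = 2 * (\<integral>t. (\<Sum>i\<in>V. \<Sum>k\<in>V. a i k * I i k t) \<partial>lborel)"
    if sym: "\<And>i k. a i k = a k i" for a :: "'a \<Rightarrow> 'a \<Rightarrow> real"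
  proof -
    have "(\<Sum>i\<in>V. \<Sum>k\<in>V. a i k * \<bar>f i - f k\<bar>)
        = (\<Sum>i\<in>V. \<Sum>k\<in>V. a i k * max 0 (f i - f k)) + (\<Sum>i\<in>V. \<Sum>k\<in>V. a i k * max 0 (f k - f i))"
      unfolding sum.distrib[symmetric] distrib_left[symmetric]
      by (intro sum.cong arg_cong2[where f="(*)"]) auto
    also have "(\<Sum>i\<in>V. \<Sum>k\<in>V. a i k * max 0 (f k - f i)) = (\<Sum>i\<in>V. \<Sum>k\<in>V. a i k * max 0 (f i - f k))"
      by (subst sum.swap) (simp add: sym)
    finally show ?thesis
      using int by (simp add: integral_sum int')
  qed
  have split: "(\<Sum>i\<in>V. \<Sum>k\<in>V. a i k * I i k t) = (\<Sum>i\<in>S t. \<Sum>k\<in>V - S t. a i k)" for t a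
  proof -
    have "(\<Sum>i\<in>V. \<Sum>k\<in>V. a i k * I i k t) = (\<Sum>i\<in>V. if i \<in> S t then \<Sum>k\<in>V. if k \<in> V - S t then a i k else 0 else 0)"
      by (intro sum.cong refl) (auto simp: I_def S_def indicator_def intro!: sum.cong sum.neutral)
    also have "\<dots> = (\<Sum>i\<in>V \<inter> S t. \<Sum>k\<in>V \<inter> (V - S t). a i k)"
      using finite_V by (simp only: sum.inter_restrict)
    also have "V \<inter> S t = S t" by (auto simp: S_def)
    also have "V \<inter> (V - S t) = V - S t" by auto
    finally show ?thesis .
  qed
  have "\<kappa> * (\<Sum>i\<in>V. \<Sum>k\<in>V. \<bar>f i - f k\<bar>) = (\<Sum>i\<in>V. \<Sum>k\<in>V. \<kappa> * \<bar>f i - f k\<bar>)"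
    by (simp add: sum_distrib_left)
  also have "\<dots> = 2 * (\<integral>t. (\<Sum>i\<in>V. \<Sum>k\<in>V. \<kappa> * I i k t) \<partial>lborel)"
    by (rule half) simp
  also have "\<dots> \<le> 2 * (\<integral>t. (\<Sum>i\<in>V. \<Sum>k\<in>V. c i k * I i k t) \<partial>lborel)"
  proof (intro mult_left_mono integral_mono)
    fix t
    show "(\<Sum>i\<in>V. \<Sum>k\<in>V. \<kappa> * I i k t) \<le> (\<Sum>i\<in>V. \<Sum>k\<in>V. c i k * I i k t)"
      unfolding split using assms[of "S t"] by (simp add: cut_def S_def mult_ac)
  qed (use int in auto)
  also have "\<dots> = (\<Sum>i\<in>V. \<Sum>k\<in>V. c i k * \<bar>f i - f k\<bar>)"
    by (rule half[symmetric]) (rule c_sym)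
  finally show ?thesis .
qed

end

text \<open>
  The median is the largest value of \<open>f\<close> below which lies at most half of \<open>V\<close>. The next larger value
  fails this, so less than half of \<open>V\<close> lies strictly above the median.
\<close>

lemma median_exists:
  fixes f :: "'a \<Rightarrow> real"
  assumes "finite V" "V \<noteq> {}"
  obtains m where "2 * card {i \<in> V. f i < m} \<le> card V" "2 * card {i \<in> V. m < f i} \<le> card V"
proof -
  define A where "A = {x \<in> f ` V. 2 * card {i \<in> V. f i < x} \<le> card V}"
  have "finite A" using assms(1) by (simp add: A_def)
  have none: "{i \<in> V. f i < Min (f ` V)} = {}"
    using assms(1) by (auto simp: not_less)
  have "Min (f ` V) \<in> A"
    unfolding A_def mem_Collect_eq none using assms by (auto intro!: Min_in)
  then have m: "Max A \<in> A" "\<And>x. x \<in> A \<Longrightarrow> x \<le> Max A"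
    using \<open>finite A\<close> by (auto intro!: Max_in)
  have "2 * card {i \<in> V. Max A < f i} \<le> card V"
  proof (cases "{i \<in> V. Max A < f i} = {}")
    case False
    define x where "x = Min (f ` {i \<in> V. Max A < f i})"
    have "x \<in> f ` {i \<in> V. Max A < f i}"
      unfolding x_def using False assms(1) by (intro Min_in) auto
    then have x: "x \<in> f ` V" "Max A < x" by auto
    have eq: "{i \<in> V. Max A < f i} = {i \<in> V. \<not> f i < x}"
    proof safe
      fix i assume "i \<in> V" "Max A < f i" "f i < x"
      moreover have "x \<le> f i" if "i \<in> V" "Max A < f i" for i
        unfolding x_def using assms(1) that by (intro Min_le) auto
      ultimately show False by force
    qed (use x in auto)
    have "x \<notin> A" using m(2)[of x] x(2) by auto
    then have "card V < 2 * card {i \<in> V. f i < x}" using x(1) by (auto simp: A_def)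
    moreover have "card {i \<in> V. f i < x} + card {i \<in> V. \<not> f i < x} = card V"
    proof -
      have "{i \<in> V. f i < x} \<union> {i \<in> V. \<not> f i < x} = V" by auto
      then show ?thesis using assms(1)
        by (subst card_Un_disjoint[symmetric]) auto
    qed
    ultimately show ?thesis unfolding eq by simp
  next
    case True
    then show ?thesis by (simp only: card.empty)
  qed
  then show ?thesis using m(1) that by (auto simp: A_def)
qed

lemma signed_square_diff_le: "\<bar>x * \<bar>x\<bar> - y * \<bar>y\<bar>\<bar> \<le> \<bar>x - y\<bar> * (\<bar>x\<bar> + \<bar>y\<bar>)" for x y :: real
proof (cases "0 \<le> x"; cases "0 \<le> y")
  assume "0 \<le> x" "0 \<le> y"
  then have "\<bar>x - y\<bar> * (\<bar>x\<bar> + \<bar>y\<bar>) = \<bar>(x - y) * (x + y)\<bar>" by (simp add: abs_mult)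
  then show ?thesis using \<open>0 \<le> x\<close> \<open>0 \<le> y\<close> by (simp add: algebra_simps)
next
  assume "0 \<le> x" "\<not> 0 \<le> y"
  then have "0 \<le> - (x * y)" by (simp add: mult_nonneg_nonpos)
  with \<open>0 \<le> x\<close> \<open>\<not> 0 \<le> y\<close> show ?thesis by (simp add: algebra_simps)
next
  assume "\<not> 0 \<le> x" "0 \<le> y"
  then have "0 \<le> - (x * y)" by (simp add: mult_nonneg_nonpos2)
  with \<open>\<not> 0 \<le> x\<close> \<open>0 \<le> y\<close> show ?thesis by (simp add: algebra_simps)
next
  assume a: "\<not> 0 \<le> x" "\<not> 0 \<le> y"
  then have "\<bar>x - y\<bar> * (\<bar>x\<bar> + \<bar>y\<bar>) = \<bar>(x - y) * (x + y)\<bar>" by (simp add: abs_mult)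
  then show ?thesis using a by (simp add: algebra_simps)
qed

lemma signed_square_diff_ge:
  fixes x y :: real
  assumes "x * y \<le> 0"
  shows "x\<^sup>2 \<le> \<bar>x * \<bar>x\<bar> - y * \<bar>y\<bar>\<bar>"
proof -
  have sq: "0 \<le> x * x" "0 \<le> y * y" by auto
  from assms consider "0 \<le> x" "y \<le> 0" | "x \<le> 0" "0 \<le> y"
    by (auto simp: mult_le_0_iff)
  then show ?thesis
  proof cases
    case 1
    then have "x * \<bar>x\<bar> - y * \<bar>y\<bar> = x * x + y * y" by simp
    with sq show ?thesis by (simp add: power2_eq_square)
  next
    case 2
    then have "x * \<bar>x\<bar> - y * \<bar>y\<bar> = - (x * x + y * y)" by simp
    with sq show ?thesis by (simp add: power2_eq_square)
  qed
qed

context weighted_graph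
begin

text \<open>
  The comparison of total variations is applied to the signed square \<open>g = f * \<bar>f\<bar>\<close>. Since at least half of the
  vertices have \<open>f k\<close> of sign opposite to \<open>f i\<close> or zero, the variation of \<open>g\<close> on the complete graph is at
  least a multiple of the sum of squares of \<open>f\<close>; on the given graph it is bounded by Cauchy-Schwarz in
  terms of the energy and again the sum of squares.
\<close>

lemma cheeger_square_sum:
  fixes f :: "'a \<Rightarrow> real" and \<kappa> W :: real
  assumes cut: "\<And>S. S \<subseteq> V \<Longrightarrow> \<kappa> * card S * card (V - S) \<le> cut S" and \<kappa>: "0 \<le> \<kappa>"
    and W: "\<And>i. i \<in> V \<Longrightarrow> deg i \<le> W" "0 \<le> W"
    and med: "2 * card {i \<in> V. f i < 0} \<le> card V" "2 * card {i \<in> V. 0 < f i} \<le> card V"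
  shows "\<kappa>\<^sup>2 * (card V)\<^sup>2 * (\<Sum>i\<in>V. (f i)\<^sup>2) \<le> 32 * W * energy f"
proof -
  define n where "n = card V"
  define Q where "Q = (\<Sum>i\<in>V. (f i)\<^sup>2)"
  define g where "g i = f i * \<bar>f i\<bar>" for i
  have Q: "0 \<le> Q" unfolding Q_def by (intro sum_nonneg) auto
  have "(n / 2) * Q \<le> (\<Sum>i\<in>V. \<Sum>k\<in>V. \<bar>g i - g k\<bar>)"
    unfolding Q_def sum_distrib_left
  proof (intro sum_mono)
    fix i assume i: "i \<in> V"
    define B where "B = {k \<in> V. f i * f k \<le> 0}"
    have "\<exists>C. V - B \<subseteq> C \<and> finite C \<and> 2 * card C \<le> n"
    proof (cases "0 < f i")
      case True
      then show ?thesis using med finite_V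
        by (intro exI[of _ "{i \<in> V. 0 < f i}"]) (auto simp: B_def n_def mult_le_0_iff)
    next
      case False
      then show ?thesis using med finite_V
        by (intro exI[of _ "{i \<in> V. f i < 0}"]) (auto simp: B_def n_def mult_le_0_iff)
    qed
    then have "2 * card (V - B) \<le> n" using card_mono by (meson le_trans mult_le_mono2)
    moreover have "card (V - B) = n - card B" "card B \<le> n" using finite_V
      by (auto simp: card_Diff_subset B_def n_def intro: card_mono)
    ultimately have B: "n / 2 \<le> real (card B)" by linarith
    have "n / 2 * (f i)\<^sup>2 \<le> card B * (f i)\<^sup>2" by (intro mult_right_mono B) auto
    also have "\<dots> = (\<Sum>k\<in>B. (f i)\<^sup>2)" by simp
    also have "\<dots> \<le> (\<Sum>k\<in>B. \<bar>g i - g k\<bar>)"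
    proof (intro sum_mono)
      fix k assume "k \<in> B"
      then have "f i * f k \<le> 0" by (simp add: B_def)
      then show "(f i)\<^sup>2 \<le> \<bar>g i - g k\<bar>"
        unfolding g_def by (rule signed_square_diff_ge)
    qed
    also have "\<dots> \<le> (\<Sum>k\<in>V. \<bar>g i - g k\<bar>)"
      using finite_V by (intro sum_mono2) (auto simp: B_def)
    finally show "n / 2 * (f i)\<^sup>2 \<le> (\<Sum>k\<in>V. \<bar>g i - g k\<bar>)" .
  qed
  then have "\<kappa> * ((n / 2) * Q) \<le> \<kappa> * (\<Sum>i\<in>V. \<Sum>k\<in>V. \<bar>g i - g k\<bar>)"
    using \<kappa> by (rule mult_left_mono)
  also have "\<dots> \<le> (\<Sum>i\<in>V. \<Sum>k\<in>V. c i k * \<bar>g i - g k\<bar>)"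
    by (rule cut_comparison) (rule cut)
  also have "\<dots> \<le> (\<Sum>i\<in>V. \<Sum>k\<in>V. c i k * (\<bar>f i - f k\<bar> * (\<bar>f i\<bar> + \<bar>f k\<bar>)))"
    unfolding g_def by (intro sum_mono mult_left_mono c_nonneg signed_square_diff_le)
  also have "\<dots> = (\<Sum>(i,k)\<in>V\<times>V. (sqrt (c i k) * \<bar>f i - f k\<bar>) * (sqrt (c i k) * (\<bar>f i\<bar> + \<bar>f k\<bar>)))"
    unfolding sum.cartesian_product
    by (simp only: sqrt_mult_sqrt[OF c_nonneg])
  finally have *: "\<kappa> * ((n / 2) * Q) \<le> \<dots>" .
  have "(\<kappa> * ((n / 2) * Q))\<^sup>2
      \<le> (\<Sum>(i,k)\<in>V\<times>V. (sqrt (c i k) * \<bar>f i - f k\<bar>) * (sqrt (c i k) * (\<bar>f i\<bar> + \<bar>f k\<bar>)))\<^sup>2"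
    using \<kappa> Q by (intro power_mono *) auto
  also have "\<dots> \<le> (\<Sum>(i,k)\<in>V\<times>V. (sqrt (c i k) * \<bar>f i - f k\<bar>)\<^sup>2) * (\<Sum>(i,k)\<in>V\<times>V. (sqrt (c i k) * (\<bar>f i\<bar> + \<bar>f k\<bar>))\<^sup>2)"
    unfolding split_def by (rule Cauchy_Schwarz_ineq_sum)
  also have "(\<Sum>(i,k)\<in>V\<times>V. (sqrt (c i k) * \<bar>f i - f k\<bar>)\<^sup>2) = 2 * energy f"
    unfolding energy_eq by (simp add: sum.cartesian_product power_mult_distrib c_nonneg)
  also have "(\<Sum>(i,k)\<in>V\<times>V. (sqrt (c i k) * (\<bar>f i\<bar> + \<bar>f k\<bar>))\<^sup>2) \<le> 4 * (W * Q)"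
  proof -
    have "(\<Sum>(i,k)\<in>V\<times>V. (sqrt (c i k) * (\<bar>f i\<bar> + \<bar>f k\<bar>))\<^sup>2) = (\<Sum>i\<in>V. \<Sum>k\<in>V. c i k * (\<bar>f i\<bar> + \<bar>f k\<bar>)\<^sup>2)"
      by (simp add: sum.cartesian_product power_mult_distrib c_nonneg)
    also have "\<dots> \<le> (\<Sum>i\<in>V. \<Sum>k\<in>V. c i k * (2 * (f i)\<^sup>2 + 2 * (f k)\<^sup>2))"
    proof (intro sum_mono mult_left_mono c_nonneg)
      fix i k
      have "0 \<le> (\<bar>f i\<bar> - \<bar>f k\<bar>)\<^sup>2" by simp
      then show "(\<bar>f i\<bar> + \<bar>f k\<bar>)\<^sup>2 \<le> 2 * (f i)\<^sup>2 + 2 * (f k)\<^sup>2"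
        by (simp add: power2_eq_square algebra_simps)
    qed
    also have "\<dots> = 2 * (\<Sum>i\<in>V. \<Sum>k\<in>V. c i k * (f i)\<^sup>2) + 2 * (\<Sum>i\<in>V. \<Sum>k\<in>V. c i k * (f k)\<^sup>2)"
      by (simp add: sum.distrib sum_distrib_left algebra_simps)
    also have "(\<Sum>i\<in>V. \<Sum>k\<in>V. c i k * (f k)\<^sup>2) = (\<Sum>i\<in>V. \<Sum>k\<in>V. c i k * (f i)\<^sup>2)"
      by (subst sum.swap) (simp add: c_sym)
    also have "(\<Sum>i\<in>V. \<Sum>k\<in>V. c i k * (f i)\<^sup>2) = (\<Sum>i\<in>V. deg i * (f i)\<^sup>2)"
      by (simp add: deg_def sum_distrib_right)
    also have "\<dots> \<le> W * Q"
      unfolding Q_def sum_distrib_left by (intro sum_mono mult_right_mono W) auto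
    finally show ?thesis by linarith
  qed
  finally have "(\<kappa> * ((n / 2) * Q))\<^sup>2 \<le> 2 * energy f * (4 * (W * Q))"
    using energy_nonneg[of f] by (simp add: mult_left_mono)
  then have "Q * (\<kappa>\<^sup>2 * n\<^sup>2 * Q) \<le> Q * (32 * W * energy f)"
    by (simp add: power_mult_distrib power_divide power2_eq_square algebra_simps)
  then show ?thesis
    using Q energy_nonneg[of f] W
    unfolding n_def[symmetric] Q_def[symmetric]
    by (cases "Q = 0") (auto simp: mult_le_cancel_left)
qed

text \<open>
  Among all shifts of \<open>f\<close>, the mean minimises the weighted sum of squares, while the median is the
  shift for which the previous bound applies; the energy is the same for all of them.
\<close>

theorem poincare_of_cut:
  fixes f :: "'a \<Rightarrow> real" and \<kappa> W :: real
  assumes cut: "\<And>S. S \<subseteq> V \<Longrightarrow> \<kappa> * card S * card (V - S) \<le> cut S" and \<kappa>: "0 \<le> \<kappa>"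
    and W: "\<And>i. i \<in> V \<Longrightarrow> deg i \<le> W" "0 < W"
    and mean: "(\<Sum>i\<in>V. deg i * f i) = 0"
  shows "(\<kappa> * card V / W)\<^sup>2 / 32 * (\<Sum>i\<in>V. deg i * (f i)\<^sup>2) \<le> energy f"
proof (cases "V = {}")
  case False
  obtain m where m: "2 * card {i \<in> V. f i < m} \<le> card V" "2 * card {i \<in> V. m < f i} \<le> card V"
    using median_exists[OF finite_V False, of f] .
  have "(\<Sum>i\<in>V. deg i * (f i)\<^sup>2) \<le> (\<Sum>i\<in>V. deg i * (f i)\<^sup>2) + m\<^sup>2 * vol"
    unfolding vol_def by (simp add: sum_nonneg deg_nonneg)
  also have "\<dots> = (\<Sum>i\<in>V. deg i * (f i)\<^sup>2) - 2 * m * (\<Sum>i\<in>V. deg i * f i) + m\<^sup>2 * vol"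
    by (simp add: mean)
  also have "\<dots> = (\<Sum>i\<in>V. deg i * (f i - m)\<^sup>2)"
    unfolding vol_def power2_diff
    by (simp add: sum.distrib sum_subtractf sum_distrib_left sum_distrib_right algebra_simps)
  also have "\<dots> \<le> W * (\<Sum>i\<in>V. (f i - m)\<^sup>2)"
    unfolding sum_distrib_left by (intro sum_mono mult_right_mono W) auto
  finally have "\<kappa>\<^sup>2 * (card V)\<^sup>2 * (\<Sum>i\<in>V. deg i * (f i)\<^sup>2)
      \<le> \<kappa>\<^sup>2 * (card V)\<^sup>2 * (W * (\<Sum>i\<in>V. (f i - m)\<^sup>2))"
    by (intro mult_left_mono) auto
  also have "\<dots> = W * (\<kappa>\<^sup>2 * (card V)\<^sup>2 * (\<Sum>i\<in>V. (f i - m)\<^sup>2))" by simp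
  also have "\<dots> \<le> W * (32 * W * energy (\<lambda>i. f i - m))"
    using W m by (intro mult_left_mono cheeger_square_sum cut \<kappa>) auto
  finally show ?thesis
    using W(2) by (simp add: energy_shift field_simps power2_eq_square)
next
  case True
  then have "card V = 0" by simp
  then show ?thesis using energy_nonneg[of f] by simp
qed

text \<open>
  The energy of a subsolution \<open>x\<close> is at most \<open>\<Sum>deg * x\<close>, which is linear in \<open>x\<close>. On the other hand \<open>x\<close>
  vanishes at \<open>j\<close>, so its variance is at least the weight of \<open>j\<close> times the square of its mean, which is
  quadratic. The gap inequality compares the two and bounds the mean.
\<close>

theorem sum_subsolution_le:
  fixes x :: "'a \<Rightarrow> real"
  assumes gap: "0 < g" "\<And>f. (\<Sum>i\<in>V. deg i * f i) = 0 \<Longrightarrow> g * (\<Sum>i\<in>V. deg i * (f i)\<^sup>2) \<le> energy f"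
    and j: "j \<in> V" "0 < deg j" and x: "\<And>i. i \<in> V \<Longrightarrow> 0 \<le> x i" "x j = 0"
    and sub: "\<And>i. i \<in> V \<Longrightarrow> i \<noteq> j \<Longrightarrow> laplacian x i \<le> deg i"
  shows "(\<Sum>i\<in>V. deg i * x i) \<le> vol\<^sup>2 / (g * deg j)"
proof -
  define s where "s = (\<Sum>i\<in>V. deg i * x i)"
  define a where "a = s / vol"
  have vol: "0 < vol" by (rule vol_pos[OF j])
  have s: "0 \<le> s" unfolding s_def by (intro sum_nonneg mult_nonneg_nonneg deg_nonneg x)
  have "(\<Sum>i\<in>V. deg i * (x i - a)) = s - a * vol"
    by (simp only: s_def vol_def right_diff_distrib sum_subtractf sum_distrib_left) (simp add: mult.commute)
  also have "\<dots> = 0" using vol by (simp add: a_def)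
  finally have "g * (\<Sum>i\<in>V. deg i * (x i - a)\<^sup>2) \<le> energy x"
    using gap(2)[of "\<lambda>i. x i - a"] by (simp add: energy_shift)
  also have "energy x \<le> s"
    unfolding energy_def s_def
  proof (rule sum_mono)
    fix i assume i: "i \<in> V"
    show "x i * laplacian x i \<le> deg i * x i"
      using mult_left_mono[OF sub[OF i] x(1)[OF i]] x(2) by (cases "i = j") (auto simp: mult.commute)
  qed
  finally have "g * (\<Sum>i\<in>V. deg i * (x i - a)\<^sup>2) \<le> s" .
  moreover have "deg j * a\<^sup>2 \<le> (\<Sum>i\<in>V. deg i * (x i - a)\<^sup>2)"
    using member_le_sum[of j V "\<lambda>i. deg i * (x i - a)\<^sup>2"] j x(2) finite_V deg_nonneg by simp
  ultimately have "g * (deg j * a\<^sup>2) \<le> s" using gap(1) by (meson mult_left_mono order.trans less_imp_le)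
  then have "s * (s * (g * deg j)) \<le> s * vol\<^sup>2"
    using vol by (simp add: a_def field_simps power2_eq_square)
  then have "s * (g * deg j) \<le> vol\<^sup>2"
    using s by (cases "s = 0") (auto simp: mult_le_cancel_left)
  then show ?thesis
    using gap(1) j(2) by (simp add: s_def field_simps)
qed

end

section \<open>Expected hitting times as tail sums\<close>

lemma nn_integral_step_pmf:
  assumes "finite E" "\<And>e. e \<in> E \<Longrightarrow> card e = d" "d \<ge> 2" "{e \<in> E. v \<in> e} \<noteq> {}"
  shows "(\<integral>\<^sup>+w. f w \<partial>step_pmf E v)
      = (\<Sum>e\<in>{e \<in> E. v \<in> e}. (\<Sum>w\<in>e - {v}. f w) / of_nat (d - 1)) / of_nat (card {e \<in> E. v \<in> e})"
proof -
  have "(\<integral>\<^sup>+w. f w \<partial>pmf_of_set (e - {v})) = (\<Sum>w\<in>e - {v}. f w) / of_nat (d - 1)"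
    if "e \<in> E" "v \<in> e" for e
  proof -
    have "card (e - {v}) = d - 1" using that assms by (simp add: card_Diff_singleton)
    moreover from this have "0 < card (e - {v})" using \<open>d \<ge> 2\<close> by linarith
    then have "finite (e - {v})" "e - {v} \<noteq> {}" by (auto simp only: card_gt_0_iff)
    ultimately show ?thesis
      using nn_integral_pmf_of_set[of "e - {v}" f] by simp
  qed
  then show ?thesis
    unfolding step_pmf_def nn_integral_bind_pmf
    using assms by (subst nn_integral_pmf_of_set) (auto intro!: sum.cong arg_cong2[where f="(/)"])
qed

text \<open>
  One step of the walk acting on functions, killed at the target. Its iterates express the
  probabilities of avoiding the target.
\<close>

definition killed_step :: "nat set set \<Rightarrow> nat \<Rightarrow> (nat \<Rightarrow> ennreal) \<Rightarrow> nat \<Rightarrow> ennreal" where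
  "killed_step E j f v = (if v = j then 0 else \<integral>\<^sup>+w. f w \<partial>step_pmf E v)"

definition alive :: "nat \<Rightarrow> nat \<Rightarrow> ennreal" where
  "alive j v = (if v = j then 0 else 1)"

text \<open>
  Trajectories are built by appending the last step, so the induction peels off the last step and
  absorbs it into the function \<open>f\<close>.
\<close>

lemma nn_integral_path_avoid:
  "(\<integral>\<^sup>+\<omega>. (\<Prod>s\<le>t. alive j (\<omega> s)) * f (\<omega> t) \<partial>walk.C E i 0 (Suc t) (\<lambda>_. undefined))
     = (killed_step E j ^^ t) (\<lambda>v. alive j v * f v) i"
proof (induction t arbitrary: f)
  case 0
  have u: "(\<lambda>_. undefined) \<in> space (PiM {0..<0} (\<lambda>_. count_space (UNIV::nat set)))"
    by (auto simp: space_PiM PiE_def extensional_def)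
  have m: "(\<lambda>\<omega>. alive j (\<omega> 0) * f (\<omega> 0)) \<in> borel_measurable (PiM {0..<Suc 0} (\<lambda>_. count_space UNIV))"
    by (rule measurable_compose[OF measurable_component_singleton]) auto
  have C1: "walk.C E i 0 (Suc 0) (\<lambda>_. undefined) = walk.eP E i 0 (\<lambda>_. undefined)"
    using bind_return[OF walk.measurable_eP[of E i 0] u] by simp
  show ?case
    unfolding C1 using m by (subst walk.nn_integral_eP[OF u]) (auto simp: walk_kernel_def)
next
  case (Suc t)
  let ?u = "\<lambda>_. undefined :: nat" and ?P = "\<lambda>t. PiM {0..<t} (\<lambda>_. count_space (UNIV::nat set))"
  have u: "?u \<in> space (?P 0)" by (auto simp: space_PiM PiE_def extensional_def)
  have coord: "(\<lambda>\<omega>. q (\<omega> s)) \<in> borel_measurable (?P r)" if "s < r" for s r :: nat and q :: "nat \<Rightarrow> ennreal"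
    by (rule measurable_compose[OF measurable_component_singleton]) (use that in auto)
  have m: "(\<lambda>\<omega>. (\<Prod>s\<le>Suc t. alive j (\<omega> s)) * f (\<omega> (Suc t))) \<in> borel_measurable (?P (Suc (Suc t)))"
    by (intro borel_measurable_times_ennreal borel_measurable_prod_ennreal coord) auto
  have "(\<integral>\<^sup>+\<omega>. (\<Prod>s\<le>Suc t. alive j (\<omega> s)) * f (\<omega> (Suc t)) \<partial>walk.C E i 0 (Suc (Suc t)) ?u)
      = (\<integral>\<^sup>+\<omega>. (\<integral>\<^sup>+\<omega>'. (\<Prod>s\<le>Suc t. alive j (\<omega>' s)) * f (\<omega>' (Suc t)) \<partial>walk.eP E i (Suc t) \<omega>)
          \<partial>walk.C E i 0 (Suc t) ?u)"
    using m walk.measurable_eP[of E i "Suc t"] walk.sets_C[OF u, of E i "Suc t"]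
    by (subst walk.C.simps, subst nn_integral_bind[where B="?P (Suc (Suc t))"])
       (auto cong: measurable_cong_sets simp del: walk.C.simps)
  also have "\<dots> = (\<integral>\<^sup>+\<omega>. (\<Prod>s\<le>t. alive j (\<omega> s)) * (\<integral>\<^sup>+x. alive j x * f x \<partial>step_pmf E (\<omega> t))
          \<partial>walk.C E i 0 (Suc t) ?u)"
  proof (rule nn_integral_cong)
    fix \<omega> assume "\<omega> \<in> space (walk.C E i 0 (Suc t) ?u)"
    then have \<omega>: "\<omega> \<in> space (?P (Suc t))" using walk.space_C[OF u, of E i "Suc t"] by simp
    show "(\<integral>\<^sup>+\<omega>'. (\<Prod>s\<le>Suc t. alive j (\<omega>' s)) * f (\<omega>' (Suc t)) \<partial>walk.eP E i (Suc t) \<omega>)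
       = (\<Prod>s\<le>t. alive j (\<omega> s)) * (\<integral>\<^sup>+x. alive j x * f x \<partial>step_pmf E (\<omega> t))"
      by (subst walk.nn_integral_eP[OF \<omega> m])
         (simp add: walk_kernel_def mult.assoc nn_integral_cmult)
  qed
  also have "\<dots> = (killed_step E j ^^ t)
      (\<lambda>v. alive j v * (\<integral>\<^sup>+x. alive j x * f x \<partial>step_pmf E v)) i"
    by (rule Suc.IH)
  also have "(\<lambda>v. alive j v * (\<integral>\<^sup>+x. alive j x * f x \<partial>step_pmf E v))
      = killed_step E j (\<lambda>v. alive j v * f v)"
    by (auto simp: killed_step_def alive_def)
  finally show ?case by (simp add: funpow_swap1)
qed

lemma prob_avoid_target:
  "emeasure (walk_measure E i) {\<omega>. \<forall>s\<le>t. \<omega> s \<noteq> j} = (killed_step E j ^^ t) (alive j) i"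
proof -
  let ?J = "{0..<Suc t}" and ?u = "\<lambda>_. undefined :: nat"
  let ?P = "PiM ?J (\<lambda>_. count_space (UNIV::nat set))"
  have u: "?u \<in> space (PiM {0..<0} (\<lambda>_. count_space (UNIV::nat set)))"
    by (auto simp: space_PiM PiE_def extensional_def)
  define X where "X = {\<omega> \<in> space ?P. \<forall>s\<le>t. \<omega> s \<noteq> j}"
  have X: "X \<in> sets ?P"
  proof -
    have "X = {\<omega> \<in> space ?P. \<forall>s\<in>{..t}. \<omega> s \<noteq> j}" by (auto simp: X_def)
    also have "\<dots> \<in> sets ?P"
      by (intro sets.sets_Collect_finite_All measurable_sets_Collect
           [OF measurable_component_singleton]) auto
    finally show ?thesis .
  qed
  have "{\<omega>. \<forall>s\<le>t. \<omega> s \<noteq> j} = prod_emb UNIV (\<lambda>_. count_space UNIV) ?J X"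
    by (auto simp: X_def prod_emb_def space_PiM)
  then have "emeasure (walk_measure E i) {\<omega>. \<forall>s\<le>t. \<omega> s \<noteq> j} = emeasure (walk.CI E i ?J) X"
    unfolding walk_measure_def using X by (simp add: walk.lim)
  also have "\<dots> = emeasure (walk.C E i 0 (Suc t) ?u) X"
    using walk.emeasure_CI[of ?J "Suc t" X E i] X sets.sets_into_space[OF X]
    by (simp add: prod_emb_id space_PiM)
  also have "\<dots> = (\<integral>\<^sup>+\<omega>. indicator X \<omega> \<partial>walk.C E i 0 (Suc t) ?u)"
    using X walk.sets_C[OF u, of E i "Suc t"] by simp
  also have "\<dots> = (\<integral>\<^sup>+\<omega>. (\<Prod>s\<le>t. alive j (\<omega> s)) * 1 \<partial>walk.C E i 0 (Suc t) ?u)"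
    using walk.space_C[OF u, of E i "Suc t"]
    by (intro nn_integral_cong) (auto simp: X_def alive_def indicator_def intro!: prod.neutral prod_zero)
  also have "\<dots> = (killed_step E j ^^ t) (alive j) i"
    by (subst nn_integral_path_avoid) simp
  finally show ?thesis .
qed

text \<open>
  A random time with values in the natural numbers or \<open>\<infinity>\<close> counts the \<open>t\<close> that it exceeds. For
  expectations this gives the tail-sum formula that follows.
\<close>

lemma hitting_time_eq_suminf: "hitting_time j \<omega> = (\<Sum>t. if \<forall>s\<le>t. \<omega> s \<noteq> j then 1 else 0)"
proof (cases "\<exists>t. \<omega> t = j")
  case True
  define T where "T = (LEAST t. \<omega> t = j)"
  have T: "\<omega> T = j" "\<And>t. \<omega> t = j \<Longrightarrow> T \<le> t"
    unfolding T_def using True by (auto intro: LeastI_ex Least_le)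
  have "hitting_time j \<omega> = of_nat T"
    unfolding hitting_time_def using T by (intro antisym INF_lower INF_greatest) auto
  moreover have iff: "(\<forall>s\<le>t. \<omega> s \<noteq> j) \<longleftrightarrow> t < T" for t
  proof
    show "t < T" if "\<forall>s\<le>t. \<omega> s \<noteq> j" using that T(1) by (cases "T \<le> t") auto
    show "\<forall>s\<le>t. \<omega> s \<noteq> j" if "t < T"
    proof (intro allI impI notI)
      fix s assume "s \<le> t" "\<omega> s = j"
      then show False using T(2)[of s] that by simp
    qed
  qed
  have "(\<Sum>t. if \<forall>s\<le>t. \<omega> s \<noteq> j then 1 else 0 :: ennreal) = (\<Sum>t<T. 1)"
    unfolding iff by (subst suminf_finite[of "{..<T}"]) auto
  ultimately show ?thesis by simp
next
  case False
  then have "hitting_time j \<omega> = top" by (simp add: hitting_time_def)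
  moreover have "(\<Sum>t. if \<forall>s\<le>t. \<omega> s \<noteq> j then 1 else 0 :: ennreal) = top"
    using False by (simp add: suminf_eq_SUP ennreal_SUP_of_nat_eq_top)
  ultimately show ?thesis by simp
qed

lemma expected_hitting_time_eq_suminf:
  "expected_hitting_time E i j = (\<Sum>t. (killed_step E j ^^ t) (alive j) i)"
proof -
  have m: "{\<omega>. \<forall>s\<le>t. \<omega> s \<noteq> j} \<in> sets (walk_measure E i)" for t
  proof -
    have "{\<omega> \<in> space (PiM UNIV (\<lambda>_. count_space (UNIV::nat set))). \<forall>s\<in>{..t}. \<omega> s \<noteq> j}
        \<in> sets (PiM UNIV (\<lambda>_. count_space UNIV))"
      by (intro sets.sets_Collect_finite_All measurable_sets_Collect
           [OF measurable_component_singleton]) auto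
    then show ?thesis by (simp add: sets_walk_measure space_PiM Ball_def)
  qed
  have "expected_hitting_time E i j
      = (\<integral>\<^sup>+\<omega>. (\<Sum>t. indicator {\<omega>. \<forall>s\<le>t. \<omega> s \<noteq> j} \<omega>) \<partial>walk_measure E i)"
    unfolding expected_hitting_time_def hitting_time_eq_suminf indicator_def mem_Collect_eq
    by (simp only: of_bool_def)
  also have "\<dots> = (\<Sum>t. emeasure (walk_measure E i) {\<omega>. \<forall>s\<le>t. \<omega> s \<noteq> j})"
    using m by (subst nn_integral_suminf) auto
  finally show ?thesis by (simp add: prob_avoid_target)
qed

lemma expected_hitting_time_self: "expected_hitting_time E j j = 0"
proof -
  have "(killed_step E j ^^ t) (alive j) j = 0" for t
    by (cases t) (auto simp: killed_step_def alive_def)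
  then show ?thesis by (simp add: expected_hitting_time_eq_suminf)
qed

text \<open>
  Each iterate of the killed step is the killed step applied to the previous iterate, so a shift of the
  tail sum by one splits off the first step.
\<close>

lemma expected_hitting_time_step:
  assumes "i \<noteq> j"
  shows "expected_hitting_time E i j = 1 + (\<integral>\<^sup>+k. expected_hitting_time E k j \<partial>step_pmf E i)"
proof -
  have "expected_hitting_time E i j = (\<Sum>t. (killed_step E j ^^ Suc t) (alive j) i) + alive j i"
    unfolding expected_hitting_time_eq_suminf
    by (subst suminf_offset[of _ 1]) (auto intro: summableI)
  also have "(\<Sum>t. (killed_step E j ^^ Suc t) (alive j) i)
      = (\<Sum>t. \<integral>\<^sup>+k. (killed_step E j ^^ t) (alive j) k \<partial>step_pmf E i)"
    using assms by (simp add: killed_step_def)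
  also have "\<dots> = (\<integral>\<^sup>+k. expected_hitting_time E k j \<partial>step_pmf E i)"
    unfolding expected_hitting_time_eq_suminf by (rule nn_integral_suminf[symmetric]) simp
  finally show ?thesis using assms by (simp add: alive_def add.commute)
qed

text \<open>
  The partial sums are the expectations of the hitting time capped at \<open>T\<close>. Unlike the hitting times
  they are known to be finite from the start.
\<close>

definition truncated_hitting_time :: "nat set set \<Rightarrow> nat \<Rightarrow> nat \<Rightarrow> nat \<Rightarrow> ennreal" where
  "truncated_hitting_time E j T i = (\<Sum>t<T. (killed_step E j ^^ t) (alive j) i)"

lemma truncated_hitting_time_le: "truncated_hitting_time E j T i \<le> of_nat T"
proof -
  have 1: "(killed_step E j ^^ t) (alive j) i \<le> 1" for t i
  proof (induction t arbitrary: i)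
    case (Suc t)
    have "(\<integral>\<^sup>+w. (killed_step E j ^^ t) (alive j) w \<partial>step_pmf E i) \<le> (\<integral>\<^sup>+w. 1 \<partial>step_pmf E i)"
      by (intro nn_integral_mono Suc)
    then have "killed_step E j ((killed_step E j ^^ t) (alive j)) i \<le> 1"
      by (auto simp only: killed_step_def measure_pmf.emeasure_space_1 nn_integral_const split: if_split)
        auto
    then show ?case by simp
  qed (simp add: alive_def)
  have "truncated_hitting_time E j T i \<le> (\<Sum>t<T. 1)"
    unfolding truncated_hitting_time_def by (intro sum_mono 1)
  then show ?thesis by simp
qed

lemma truncated_hitting_time_mono: "truncated_hitting_time E j T i \<le> truncated_hitting_time E j (Suc T) i"
  by (simp add: truncated_hitting_time_def)

lemma truncated_hitting_time_self: "truncated_hitting_time E j T j = 0"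
proof -
  have "(killed_step E j ^^ t) (alive j) j = 0" for t
    by (cases t) (auto simp: killed_step_def alive_def)
  then show ?thesis by (simp add: truncated_hitting_time_def)
qed

lemma truncated_hitting_time_step:
  assumes "i \<noteq> j"
  shows "truncated_hitting_time E j (Suc T) i = 1 + (\<integral>\<^sup>+k. truncated_hitting_time E j T k \<partial>step_pmf E i)"
  using assms unfolding truncated_hitting_time_def
  by (subst sum.lessThan_Suc_shift) (simp add: killed_step_def alive_def nn_integral_sum)

lemma expected_hitting_time_eq_SUP: "expected_hitting_time E i j = (SUP T. truncated_hitting_time E j T i)"
  unfolding expected_hitting_time_eq_suminf truncated_hitting_time_def by (rule suminf_eq_SUP)

section \<open>The weighted graph of a hypergraph\<close>

lemma finite_hyperedges [simp]: "finite (hyperedges d n)"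
  unfolding hyperedges_def by (rule finite_subset[of _ "Pow {1..n}"]) auto

text \<open>
  The vertex set \<open>{1..n}\<close> occurs as a parameter of every graph quantity below. Rewriting \<open>1\<close> to
  \<open>Suc 0\<close> inside it would separate these terms from the facts stated about them.
\<close>

declare One_nat_def [simp del]

text \<open>
  The number of edges between \<open>i\<close> and \<open>k\<close> in the multigraph on which the walk moves.
\<close>

definition codegree :: "nat set set \<Rightarrow> nat \<Rightarrow> nat \<Rightarrow> real" where
  "codegree E i k = (if i = k then 0 else real (card {e \<in> E. i \<in> e \<and> k \<in> e}))"

interpretation hypergraph: weighted_graph "{1..n}" "codegree E" for n E
  by unfold_locales (auto simp: codegree_def conj_commute)

context
  fixes d n :: nat and E :: "nat set set"
  assumes E: "E \<subseteq> hyperedges d n" and d: "2 \<le> d"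
begin

lemma finite_edge_set: "finite E"
  using E finite_hyperedges by (rule finite_subset)

lemma edge_subset_card: "e \<in> E \<Longrightarrow> e \<subseteq> {1..n} \<and> card e = d"
  using E by (auto simp: hyperedges_def)

lemma sum_neighbours_eq_codegree:
  fixes f :: "nat \<Rightarrow> real"
  shows "(\<Sum>e\<in>{e \<in> E. v \<in> e}. \<Sum>w\<in>e - {v}. f w) = (\<Sum>k\<in>{1..n}. codegree E v k * f k)"
proof -
  have "(\<Sum>e\<in>{e \<in> E. v \<in> e}. \<Sum>w\<in>e - {v}. f w)
      = (\<Sum>e\<in>{e \<in> E. v \<in> e}. \<Sum>w\<in>{1..n}. if w \<in> e - {v} then f w else 0)"
  proof (rule sum.cong[OF refl])
    fix e assume "e \<in> {e \<in> E. v \<in> e}"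
    then have "{1..n} \<inter> (e - {v}) = e - {v}" using edge_subset_card by auto
    then show "sum f (e - {v}) = (\<Sum>w\<in>{1..n}. if w \<in> e - {v} then f w else 0)"
      by (metis sum.inter_restrict finite_atLeastAtMost)
  qed
  also have "\<dots> = (\<Sum>w\<in>{1..n}. \<Sum>e\<in>{e \<in> E. v \<in> e}. if w \<in> e - {v} then f w else 0)"
    by (rule sum.swap)
  also have "\<dots> = (\<Sum>k\<in>{1..n}. codegree E v k * f k)"
  proof (intro sum.cong refl)
    fix w
    have "(\<Sum>e\<in>{e \<in> E. v \<in> e}. if w \<in> e - {v} then f w else 0)
        = (\<Sum>e\<in>{e \<in> {e \<in> E. v \<in> e}. w \<in> e - {v}}. f w)"
      using finite_edge_set by (intro sum.inter_filter[symmetric]) auto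
    also have "\<dots> = codegree E v w * f w"
      by (auto simp: codegree_def conj_ac intro!: arg_cong[where f=card])
    finally show "(\<Sum>e\<in>{e \<in> E. v \<in> e}. if w \<in> e - {v} then f w else 0) = codegree E v w * f w" .
  qed
  finally show ?thesis .
qed

lemma deg_eq_walk_degree: "hypergraph.deg n E v = real (walk_degree d E v)"
proof -
  have "hypergraph.deg n E v = (\<Sum>e\<in>{e \<in> E. v \<in> e}. \<Sum>w\<in>e - {v}. 1)"
    unfolding sum_neighbours_eq_codegree hypergraph.deg_def by simp
  also have "\<dots> = (\<Sum>e\<in>{e \<in> E. v \<in> e}. real (d - 1))"
    using edge_subset_card d by (intro sum.cong refl) (auto simp: card_Diff_singleton)
  finally show ?thesis by (simp add: walk_degree_def)
qed

lemma nn_integral_step_codegree: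
  assumes v: "0 < hypergraph.deg n E v"
    and F: "\<And>k. k \<in> {1..n} \<Longrightarrow> F k = ennreal (f k)" "\<And>k. k \<in> {1..n} \<Longrightarrow> 0 \<le> f k"
  shows "(\<integral>\<^sup>+w. F w \<partial>step_pmf E v) = ennreal ((\<Sum>k\<in>{1..n}. codegree E v k * f k) / hypergraph.deg n E v)"
proof -
  let ?Ev = "{e \<in> E. v \<in> e}"
  have card: "0 < card ?Ev" using v by (auto simp: deg_eq_walk_degree walk_degree_def intro!: Nat.gr0I)
  then have "?Ev \<noteq> {}" by force
  then have "(\<integral>\<^sup>+w. F w \<partial>step_pmf E v)
      = (\<Sum>e\<in>?Ev. (\<Sum>w\<in>e - {v}. F w) / of_nat (d - 1)) / of_nat (card ?Ev)"
    using finite_edge_set edge_subset_card d by (intro nn_integral_step_pmf) auto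
  also have "\<dots> = (\<Sum>e\<in>?Ev. ennreal ((\<Sum>w\<in>e - {v}. f w) / real (d - 1))) / of_nat (card ?Ev)"
  proof (intro arg_cong2[where f="(/)"] sum.cong refl)
    fix e assume "e \<in> ?Ev"
    then have e: "w \<in> {1..n}" if "w \<in> e - {v}" for w using edge_subset_card[of e] that by auto
    have "(\<Sum>w\<in>e - {v}. F w) = (\<Sum>w\<in>e - {v}. ennreal (f w))" 
      using e F by (intro sum.cong) auto
    also have "\<dots> = ennreal (\<Sum>w\<in>e - {v}. f w)" using e F by (intro sum_ennreal) auto
    finally show "(\<Sum>w\<in>e - {v}. F w) / of_nat (d - 1) = ennreal ((\<Sum>w\<in>e - {v}. f w) / real (d - 1))"
      using d e F by (subst divide_ennreal[symmetric]) (auto intro!: sum_nonneg simp: ennreal_of_nat_eq_real_of_nat)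
  qed
  also have "\<dots> = ennreal ((\<Sum>e\<in>?Ev. (\<Sum>w\<in>e - {v}. f w) / real (d - 1)) / real (card ?Ev))"
  proof -
    have nn: "0 \<le> (\<Sum>w\<in>e - {v}. f w) / real (d - 1)" if "e \<in> ?Ev" for e
      using F(2) edge_subset_card[of e] that by (intro divide_nonneg_nonneg sum_nonneg) auto
    then have "(\<Sum>e\<in>?Ev. ennreal ((\<Sum>w\<in>e - {v}. f w) / real (d - 1)))
        = ennreal (\<Sum>e\<in>?Ev. (\<Sum>w\<in>e - {v}. f w) / real (d - 1))" by (intro sum_ennreal) simp
    moreover have "0 \<le> (\<Sum>e\<in>?Ev. (\<Sum>w\<in>e - {v}. f w) / real (d - 1))"
      by (rule sum_nonneg) (rule nn)
    ultimately show ?thesis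
      using card by (simp only: ennreal_of_nat_eq_real_of_nat divide_ennreal of_nat_0_less_iff)
  qed
  also have "(\<Sum>e\<in>?Ev. (\<Sum>w\<in>e - {v}. f w) / real (d - 1)) / real (card ?Ev)
      = (\<Sum>e\<in>?Ev. \<Sum>w\<in>e - {v}. f w) / hypergraph.deg n E v"
    by (simp add: sum_divide_distrib[symmetric] deg_eq_walk_degree walk_degree_def)
  finally show ?thesis unfolding sum_neighbours_eq_codegree .
qed

lemma card_crossing_le_cut:
  assumes S: "S \<subseteq> {1..n}"
  shows "real (card {e \<in> E. e \<inter> S \<noteq> {} \<and> \<not> e \<subseteq> S}) \<le> hypergraph.cut n E S"
proof -
  let ?V = "{1..n}"
  have fin: "finite S" using S finite_subset by blast
  have "hypergraph.cut n E S = (\<Sum>i\<in>S. \<Sum>k\<in>?V - S. \<Sum>e\<in>E. if i \<in> e \<and> k \<in> e then 1 else 0)"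
    unfolding hypergraph.cut_def
  proof (intro sum.cong refl)
    fix i k assume "i \<in> S" "k \<in> ?V - S"
    then show "codegree E i k = (\<Sum>e\<in>E. if i \<in> e \<and> k \<in> e then 1 else 0)"
      using finite_edge_set by (subst sum.inter_filter[symmetric]) (auto simp: codegree_def)
  qed
  also have "\<dots> = (\<Sum>i\<in>S. \<Sum>e\<in>E. \<Sum>k\<in>?V - S. if i \<in> e \<and> k \<in> e then 1 else 0)"
    by (intro sum.cong refl sum.swap)
  also have "\<dots> = (\<Sum>e\<in>E. \<Sum>i\<in>S. \<Sum>k\<in>?V - S. if i \<in> e \<and> k \<in> e then 1 else 0)"
    by (rule sum.swap)
  finally have eq: "hypergraph.cut n E S = \<dots>" .
  have "real (card {e \<in> E. e \<inter> S \<noteq> {} \<and> \<not> e \<subseteq> S})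
      = (\<Sum>e\<in>E. if e \<inter> S \<noteq> {} \<and> \<not> e \<subseteq> S then 1 else 0)"
    using finite_edge_set by (subst sum.inter_filter[symmetric]) auto
  also have "\<dots> \<le> (\<Sum>e\<in>E. \<Sum>i\<in>S. \<Sum>k\<in>?V - S. if i \<in> e \<and> k \<in> e then 1 else 0)"
  proof (rule sum_mono)
    fix e assume e: "e \<in> E"
    show "(if e \<inter> S \<noteq> {} \<and> \<not> e \<subseteq> S then 1 else 0)
        \<le> (\<Sum>i\<in>S. \<Sum>k\<in>?V - S. if i \<in> e \<and> k \<in> e then 1 else (0::real))"
    proof (cases "e \<inter> S \<noteq> {} \<and> \<not> e \<subseteq> S")
      case True
      then obtain i k where ik: "i \<in> e" "i \<in> S" "k \<in> e" "k \<notin> S" by auto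
      then have k: "k \<in> ?V - S" using edge_subset_card[OF e] by auto
      have "1 \<le> (\<Sum>k\<in>?V - S. if i \<in> e \<and> k \<in> e then 1 else (0::real))"
        using member_le_sum[OF k, of "\<lambda>k. if i \<in> e \<and> k \<in> e then 1 else (0::real)"] ik by simp
      also have "\<dots> \<le> (\<Sum>i\<in>S. \<Sum>k\<in>?V - S. if i \<in> e \<and> k \<in> e then 1 else (0::real))"
        using fin ik by (intro member_le_sum[where f="\<lambda>i. \<Sum>k\<in>?V - S. if i \<in> e \<and> k \<in> e then 1 else (0::real)"])
          (auto intro!: sum_nonneg)
      finally show ?thesis using True by simp
    next
      case False
      then show ?thesis by (auto intro!: sum_nonneg)
    qed
  qed
  finally show ?thesis unfolding eq .
qed

text \<open>
  The set of vertices reached from \<open>u\<close> by chains of hyperedges has no hyperedge across its boundary,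
  because such a hyperedge would extend a chain.
\<close>

lemma connected_of_crossing:
  assumes cross: "\<And>S. S \<subseteq> {1..n} \<Longrightarrow> S \<noteq> {} \<Longrightarrow> S \<noteq> {1..n} \<Longrightarrow> \<exists>e\<in>E. e \<inter> S \<noteq> {} \<and> \<not> e \<subseteq> S"
  shows "connected_hypergraph n E"
  unfolding connected_hypergraph_def
proof (intro ballI impI)
  let ?chain = "\<lambda>u v es. es \<noteq> [] \<and> set es \<subseteq> E \<and> u \<in> hd es \<and> v \<in> last es \<and> successively (\<lambda>e e'. e \<inter> e' \<noteq> {}) es"
  fix u v assume u: "u \<in> {1..n}" and v: "v \<in> {1..n}" and uv: "u \<noteq> v"
  define R where "R = {w \<in> {1..n}. w = u \<or> (\<exists>es. ?chain u w es)}"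
  have "R = {1..n}"
  proof (rule ccontr)
    assume "R \<noteq> {1..n}"
    moreover have "R \<subseteq> {1..n}" "u \<in> R" using u by (auto simp: R_def)
    ultimately obtain e where e: "e \<in> E" "e \<inter> R \<noteq> {}" "\<not> e \<subseteq> R" using cross[of R] by auto
    then obtain x y where xy: "x \<in> e" "x \<in> R" "y \<in> e" "y \<notin> R" by auto
    have y: "y \<in> {1..n}" using xy edge_subset_card[OF e(1)] by auto
    have "\<exists>es. ?chain u y es"
    proof (cases "x = u")
      case True
      then show ?thesis using xy e by (intro exI[of _ "[e]"]) auto
    next
      case False
      then obtain es where "?chain u x es" using xy by (auto simp: R_def)
      then show ?thesis using xy e
        by (intro exI[of _ "es @ [e]"]) (auto simp: successively_append_iff)
    qed
    then show False using xy y by (auto simp: R_def)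
  qed
  then show "\<exists>es. ?chain u v es" using v uv by (auto simp: R_def)
qed

context
  fixes j :: nat and g :: real
  assumes j: "j \<in> {1..n}" and deg_pos: "\<And>i. i \<in> {1..n} \<Longrightarrow> 0 < hypergraph.deg n E i"
    and gap: "0 < g" "\<And>f. (\<Sum>i\<in>{1..n}. hypergraph.deg n E i * f i) = 0 \<Longrightarrow>
        g * (\<Sum>i\<in>{1..n}. hypergraph.deg n E i * (f i)\<^sup>2) \<le> hypergraph.energy n E f"
begin

text \<open>
  The hitting times capped at \<open>T\<close> increase in \<open>T\<close>, so the first-step equation, which relates the cap
  \<open>T + 1\<close> to \<open>T\<close>, makes them subsolutions, and the bound for subsolutions does not depend on \<open>T\<close>.
\<close>

lemma expected_hitting_time_finite:
  assumes i: "i \<in> {1..n}"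
  shows "expected_hitting_time E i j < \<infinity>"
proof -
  let ?deg = "hypergraph.deg n E"
  let ?B = "(hypergraph.vol n E)\<^sup>2 / (g * ?deg j) / ?deg i"
  have "truncated_hitting_time E j T i \<le> ennreal ?B" for T
  proof -
    define x where "x T k = enn2real (truncated_hitting_time E j T k)" for T k
    have fin: "truncated_hitting_time E j T k < \<infinity>" for T k
      using truncated_hitting_time_le[of E j T k] by (simp add: le_less_trans ennreal_of_nat_eq_real_of_nat)
    then have x: "truncated_hitting_time E j T k = ennreal (x T k)" "0 \<le> x T k" for T k
      by (auto simp: x_def)
    have mono: "x T k \<le> x (Suc T) k" for k
      using truncated_hitting_time_mono[of E j T k] x by simp
    have sub: "hypergraph.laplacian n E (x T) k \<le> ?deg k" if k: "k \<in> {1..n}" "k \<noteq> j" for k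
    proof -
      have "ennreal (x (Suc T) k) = 1 + ennreal ((\<Sum>l\<in>{1..n}. codegree E k l * x T l) / ?deg k)"
        using truncated_hitting_time_step[of k j E T] k nn_integral_step_codegree[OF deg_pos[OF k(1)], of "truncated_hitting_time E j T" "x T"] x
        by simp
      also have "\<dots> = ennreal (1 + (\<Sum>l\<in>{1..n}. codegree E k l * x T l) / ?deg k)"
        using deg_pos[OF k(1)] x(2) hypergraph.c_nonneg
        by (subst ennreal_plus) (auto intro!: divide_nonneg_nonneg sum_nonneg)
      finally have "x (Suc T) k = 1 + (\<Sum>l\<in>{1..n}. codegree E k l * x T l) / ?deg k"
        using deg_pos[OF k(1)] x(2) hypergraph.c_nonneg
        by (subst (asm) ennreal_inj) (auto intro!: add_nonneg_nonneg divide_nonneg_nonneg sum_nonneg)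
      then have "?deg k * x (Suc T) k = ?deg k + (\<Sum>l\<in>{1..n}. codegree E k l * x T l)"
        using deg_pos[OF k(1)] by (simp add: field_simps)
      moreover have "?deg k * x T k \<le> ?deg k * x (Suc T) k"
        using deg_pos[OF k(1)] mono[of k] by simp
      ultimately show ?thesis unfolding hypergraph.laplacian_def by linarith
    qed
    have "?deg i * x T i \<le> (\<Sum>k\<in>{1..n}. ?deg k * x T k)"
      using i x(2) by (intro member_le_sum[where f="\<lambda>k. ?deg k * x T k"])
        (auto intro!: mult_nonneg_nonneg hypergraph.deg_nonneg)
    also have "\<dots> \<le> (hypergraph.vol n E)\<^sup>2 / (g * ?deg j)"
      by (rule hypergraph.sum_subsolution_le[OF gap j deg_pos[OF j]])
        (auto simp: x(2) sub x_def[of T j] truncated_hitting_time_self)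
    finally have "x T i \<le> ?B" using deg_pos[OF i]
      by (subst pos_le_divide_eq) (auto simp: mult.commute)
    then show ?thesis by (simp add: x(1) ennreal_leI)
  qed
  then have "expected_hitting_time E i j \<le> ennreal ?B"
    unfolding expected_hitting_time_eq_SUP by (rule SUP_least)
  also have "\<dots> < \<infinity>" by simp
  finally show ?thesis .
qed

lemma average_target_hitting_time_bounds:
  assumes return: "\<And>i. i \<in> {1..n} \<Longrightarrow> codegree E i j \<le> \<delta> * hypergraph.deg n E i"
  shows "ennreal (hypergraph.vol n E / hypergraph.deg n E j - 2) \<le> average_target_hitting_time d n E j"
    and "average_target_hitting_time d n E j
      \<le> ennreal (hypergraph.vol n E / hypergraph.deg n E j * (1 + \<delta> / g))"
proof -
  let ?deg = "hypergraph.deg n E" and ?vol = "hypergraph.vol n E"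
  define h where "h k = enn2real (expected_hitting_time E k j)" for k
  have h: "expected_hitting_time E k j = ennreal (h k)" if "k \<in> {1..n}" for k
    using expected_hitting_time_finite[OF that] by (simp add: h_def)
  have h0: "0 \<le> h k" for k by (simp add: h_def)
  have hj: "h j = 0" by (simp add: h_def expected_hitting_time_self)
  have step: "hypergraph.laplacian n E h k = ?deg k" if k: "k \<in> {1..n}" "k \<noteq> j" for k
  proof -
    have nn: "0 \<le> (\<Sum>l\<in>{1..n}. codegree E k l * h l) / ?deg k"
      using h0 hypergraph.c_nonneg hypergraph.deg_nonneg
      by (auto intro!: divide_nonneg_nonneg sum_nonneg)
    have "ennreal (h k) = 1 + ennreal ((\<Sum>l\<in>{1..n}. codegree E k l * h l) / ?deg k)"
      using expected_hitting_time_step[of k j E] k h h0 nn_integral_step_codegree[OF deg_pos[OF k(1)]] 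
      by auto
    also have "\<dots> = ennreal (1 + (\<Sum>l\<in>{1..n}. codegree E k l * h l) / ?deg k)"
      using nn by simp
    finally have "h k = 1 + (\<Sum>l\<in>{1..n}. codegree E k l * h l) / ?deg k"
      using nn h0 by (subst (asm) ennreal_inj) auto
    then have "?deg k * h k = ?deg k + (\<Sum>l\<in>{1..n}. codegree E k l * h l)"
      using deg_pos[OF k(1)] by (simp add: field_simps)
    then show ?thesis unfolding hypergraph.laplacian_def by linarith
  qed
  have "average_target_hitting_time d n E j = (\<Sum>i\<in>{1..n}. ennreal (?deg i / ?vol * h i))"
    unfolding average_target_hitting_time_def
  proof (intro sum.cong refl)
    fix i assume i: "i \<in> {1..n}"
    have "invariant_prob d n E i = ?deg i / ?vol"
      by (simp add: invariant_prob_def deg_eq_walk_degree hypergraph.vol_def)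
    then show "ennreal (invariant_prob d n E i) * expected_hitting_time E i j = ennreal (?deg i / ?vol * h i)"
      using h[OF i] h0 hypergraph.deg_nonneg hypergraph.vol_nonneg
      by (simp add: ennreal_mult[symmetric])
  qed
  also have "\<dots> = ennreal (\<Sum>i\<in>{1..n}. ?deg i / ?vol * h i)"
    using h0 hypergraph.deg_nonneg
    by (intro sum_ennreal) (auto intro!: mult_nonneg_nonneg divide_nonneg_nonneg hypergraph.vol_nonneg)
  also have "(\<Sum>i\<in>{1..n}. ?deg i / ?vol * h i) = hypergraph.mean_hitting n E h"
    unfolding hypergraph.mean_hitting_def by (simp add: sum_divide_distrib)
  finally have avg: "average_target_hitting_time d n E j = ennreal (hypergraph.mean_hitting n E h)" .
  show "ennreal (?vol / ?deg j - 2) \<le> average_target_hitting_time d n E j"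
    unfolding avg by (intro ennreal_leI hypergraph.mean_hitting_lower[OF j deg_pos hj step])
  show "average_target_hitting_time d n E j \<le> ennreal (?vol / ?deg j * (1 + \<delta> / g))"
    unfolding avg by (intro ennreal_leI hypergraph.mean_hitting_upper[OF j deg_pos hj step] gap return)
qed

end
end

section \<open>Edge counts of the random hypergraph\<close>

lemma exp_le_quadratic:
  assumes "\<bar>t\<bar> \<le> (1::real)"
  shows "exp t \<le> 1 + t + t\<^sup>2"
proof (cases "0 \<le> t")
  case True
  then show ?thesis using assms exp_bound[of t] by simp
next
  case False
  define s where "s = - t"
  have s: "0 < s" "s \<le> 1" using False assms by (auto simp: s_def)
  have "exp t = 1 / exp s" by (simp add: s_def exp_minus inverse_eq_divide)
  also have "\<dots> \<le> 1 / (1 + s)"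
    using s exp_ge_add_one_self[of s] by (intro divide_left_mono) (auto intro!: mult_pos_pos)
  also have "\<dots> \<le> 1 - s + s\<^sup>2"
  proof -
    have "(1 - s + s\<^sup>2) * (1 + s) = 1 + s ^ 3" by (simp add: power2_eq_square power3_eq_cube algebra_simps)
    then have "1 \<le> (1 - s + s\<^sup>2) * (1 + s)" using s by simp
    then show ?thesis using s by (simp add: pos_divide_le_eq)
  qed
  finally show ?thesis by (simp add: s_def)
qed

lemma set_random_hypergraph: "set_pmf (random_hypergraph d n p) \<subseteq> Pow (hyperedges d n)"
  by (auto simp: random_hypergraph_def)

lemma integrable_random_hypergraph [simp]:
  fixes f :: "nat set set \<Rightarrow> real"
  shows "integrable (measure_pmf (random_hypergraph d n p)) f"
  by (rule integrable_measure_pmf_finite)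
     (rule finite_subset[OF set_random_hypergraph], simp)

context
  fixes d n :: nat and p :: real
  assumes p: "0 \<le> p" "p \<le> 1"
begin

text \<open>
  The count is binomial; this is its moment generating function, from the independence of the edges.
\<close>

lemma edge_count_mgf:
  assumes F: "F \<subseteq> hyperedges d n"
  shows "measure_pmf.expectation (random_hypergraph d n p) (\<lambda>E. exp (t * real (card (E \<inter> F))))
       = (1 - p + p * exp t) ^ card F"
proof -
  let ?H = "hyperedges d n"
  have "measure_pmf.expectation (random_hypergraph d n p) (\<lambda>E. exp (t * real (card (E \<inter> F))))
      = measure_pmf.expectation (Pi_pmf ?H False (\<lambda>_. bernoulli_pmf p))
          (\<lambda>f. \<Prod>e\<in>?H. if e \<in> F \<and> f e then exp t else 1)"
    unfolding random_hypergraph_def integral_map_pmf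
  proof (rule Bochner_Integration.integral_cong[OF refl])
    fix f :: "nat set \<Rightarrow> bool"
    have "(\<Prod>e\<in>?H. if e \<in> F \<and> f e then exp t else 1) = (\<Prod>e\<in>{e \<in> ?H. e \<in> F \<and> f e}. exp t)"
      by (rule prod.inter_filter[symmetric]) simp
    also have "{e \<in> ?H. e \<in> F \<and> f e} = {e \<in> ?H. f e} \<inter> F" by auto
    finally show "exp (t * real (card ({e \<in> ?H. f e} \<inter> F))) = (\<Prod>e\<in>?H. if e \<in> F \<and> f e then exp t else 1)"
      by (simp add: exp_of_nat_mult[symmetric] mult.commute)
  qed
  also have "\<dots> = (\<Prod>e\<in>?H. measure_pmf.expectation (bernoulli_pmf p) (\<lambda>b. if e \<in> F \<and> b then exp t else 1))"
    by (rule expectation_prod_Pi_pmf) (auto intro!: integrable_measure_pmf_finite)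
  also have "\<dots> = (\<Prod>e\<in>?H. if e \<in> F then 1 - p + p * exp t else 1)"
    using p by (intro prod.cong refl) auto
  also have "\<dots> = (1 - p + p * exp t) ^ card F"
    using F by (subst prod.inter_filter[symmetric]) (auto simp: Int_absorb1 Int_def[symmetric] Collect_conj_eq)
  finally show ?thesis .
qed

text \<open>
  The exponential Markov inequality for both tails at once: the sign of \<open>t\<close> selects the tail. On
  \<open>[-1, 1]\<close> the quadratic bound for \<open>exp\<close> suffices for all constants needed later.
\<close>

lemma edge_count_chernoff:
  assumes F: "F \<subseteq> hyperedges d n" and t: "\<bar>t\<bar> \<le> 1"
  shows "measure_pmf.prob (random_hypergraph d n p) {E. t * a \<le> t * real (card (E \<inter> F))}
       \<le> exp (p * real (card F) * (t + t\<^sup>2) - t * a)"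
proof -
  let ?P = "random_hypergraph d n p"
  have "measure_pmf.prob ?P {E. t * a \<le> t * real (card (E \<inter> F))}
      = measure_pmf.expectation ?P (indicator {E. t * a \<le> t * real (card (E \<inter> F))})"
    by simp
  also have "\<dots> \<le> measure_pmf.expectation ?P (\<lambda>E. exp (- (t * a)) * exp (t * real (card (E \<inter> F))))"
    by (intro integral_mono) (auto simp: indicator_def exp_add[symmetric] simp del: exp_minus)
  also have "\<dots> = exp (- (t * a)) * (1 - p + p * exp t) ^ card F"
    by (subst integral_mult_right_zero) (simp add: edge_count_mgf[OF F])
  also have "\<dots> \<le> exp (- (t * a)) * exp (p * (t + t\<^sup>2)) ^ card F"
  proof (intro mult_left_mono power_mono)
    have "p * exp t \<le> p * (1 + t + t\<^sup>2)" using p exp_le_quadratic[OF t] by (intro mult_left_mono)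
    then have "1 - p + p * exp t \<le> 1 + p * (t + t\<^sup>2)" by (simp add: algebra_simps)
    also have "\<dots> \<le> exp (p * (t + t\<^sup>2))" by (rule exp_ge_add_one_self)
    finally show "1 - p + p * exp t \<le> exp (p * (t + t\<^sup>2))" .
    show "0 \<le> 1 - p + p * exp t" using p by simp
  qed simp
  also have "\<dots> = exp (p * real (card F) * (t + t\<^sup>2) - t * a)"
    by (simp add: exp_of_nat_mult[symmetric] exp_add[symmetric] algebra_simps)
  finally show ?thesis .
qed

text \<open>
  A lower bound \<open>m\<close> for the mean is enough, so cuts can be treated without knowing the exact number of
  crossing hyperedges.
\<close>

lemma edge_count_lower_tail:
  assumes F: "F \<subseteq> hyperedges d n" and m: "m \<le> p * real (card F)" and \<eta>: "0 \<le> \<eta>" "\<eta> \<le> 1"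
  shows "measure_pmf.prob (random_hypergraph d n p) {E. real (card (E \<inter> F)) \<le> (1 - \<eta>) * m}
       \<le> exp (- (m * \<eta>\<^sup>2 / 4))"
proof (cases "\<eta> = 0")
  case False
  let ?\<mu> = "p * real (card F)"
  have "(1 - \<eta>) * m \<le> (1 - \<eta>) * ?\<mu>" using m \<eta> by (intro mult_left_mono) auto
  then have "measure_pmf.prob (random_hypergraph d n p) {E. real (card (E \<inter> F)) \<le> (1 - \<eta>) * m}
      \<le> measure_pmf.prob (random_hypergraph d n p) {E. real (card (E \<inter> F)) \<le> (1 - \<eta>) * ?\<mu>}"
    by (intro measure_pmf.finite_measure_mono) auto
  also have "\<dots> = measure_pmf.prob (random_hypergraph d n p)
      {E. - (\<eta> / 2) * ((1 - \<eta>) * ?\<mu>) \<le> - (\<eta> / 2) * real (card (E \<inter> F))}"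
    using \<eta> False by simp
  also have "\<dots> \<le> exp (?\<mu> * (- (\<eta> / 2) + (- (\<eta> / 2))\<^sup>2) - - (\<eta> / 2) * ((1 - \<eta>) * ?\<mu>))"
    using \<eta> by (intro edge_count_chernoff F) simp
  also have "\<dots> = exp (- (?\<mu> * \<eta>\<^sup>2 / 4))"
    by (simp add: power2_eq_square algebra_simps)
  also have "\<dots> \<le> exp (- (m * \<eta>\<^sup>2 / 4))"
    using mult_right_mono[OF m zero_le_power2[of \<eta>]] by simp
  finally show ?thesis .
qed simp

lemma edge_count_upper_tail:
  assumes F: "F \<subseteq> hyperedges d n" and \<eta>: "0 \<le> \<eta>" "\<eta> \<le> 2"
  shows "measure_pmf.prob (random_hypergraph d n p) {E. (1 + \<eta>) * (p * real (card F)) \<le> real (card (E \<inter> F))}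
       \<le> exp (- (p * real (card F) * \<eta>\<^sup>2 / 4))"
proof (cases "\<eta> = 0")
  case False
  let ?\<mu> = "p * real (card F)"
  have "measure_pmf.prob (random_hypergraph d n p) {E. (1 + \<eta>) * ?\<mu> \<le> real (card (E \<inter> F))}
      = measure_pmf.prob (random_hypergraph d n p) {E. \<eta> / 2 * ((1 + \<eta>) * ?\<mu>) \<le> \<eta> / 2 * real (card (E \<inter> F))}"
    using \<eta> False by simp
  also have "\<dots> \<le> exp (?\<mu> * (\<eta> / 2 + (\<eta> / 2)\<^sup>2) - \<eta> / 2 * ((1 + \<eta>) * ?\<mu>))"
    using \<eta> by (intro edge_count_chernoff F) simp
  also have "\<dots> = exp (- (?\<mu> * \<eta>\<^sup>2 / 4))"
    by (simp add: power2_eq_square algebra_simps)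
  finally show ?thesis .
qed simp

lemma edge_count_large_deviation:
  assumes F: "F \<subseteq> hyperedges d n"
  shows "measure_pmf.prob (random_hypergraph d n p) {E. a \<le> real (card (E \<inter> F))}
       \<le> exp (2 * (p * real (card F)) - a)"
  using edge_count_chernoff[OF F, of 1 a] by (simp add: mult.commute)

end

lemma card_hyperedges_containing:
  assumes A: "A \<subseteq> {1..n}" "card A \<le> d"
  shows "card {e \<in> hyperedges d n. A \<subseteq> e} = (n - card A) choose (d - card A)"
proof -
  have fin: "finite A" using A finite_subset by blast
  have "bij_betw (\<lambda>e. e - A) {e \<in> hyperedges d n. A \<subseteq> e} {B. B \<subseteq> {1..n} - A \<and> card B = d - card A}"
  proof (rule bij_betwI[where g="\<lambda>B. B \<union> A"])
    show "(\<lambda>e. e - A) \<in> {e \<in> hyperedges d n. A \<subseteq> e} \<rightarrow> {B. B \<subseteq> {1..n} - A \<and> card B = d - card A}"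
      using fin by (auto simp: hyperedges_def card_Diff_subset)
    show "(\<lambda>B. B \<union> A) \<in> {B. B \<subseteq> {1..n} - A \<and> card B = d - card A} \<rightarrow> {e \<in> hyperedges d n. A \<subseteq> e}"
    proof (intro funcsetI CollectI conjI)
      fix B assume "B \<in> {B. B \<subseteq> {1..n} - A \<and> card B = d - card A}"
      then have B: "B \<subseteq> {1..n} - A" "card B = d - card A" by auto
      have "card (B \<union> A) = card B + card A"
        using B fin by (intro card_Un_disjoint) (auto intro: finite_subset)
      then show "B \<union> A \<in> hyperedges d n" using B A by (auto simp: hyperedges_def)
    qed auto
  qed auto
  then have "card {e \<in> hyperedges d n. A \<subseteq> e} = card {B. B \<subseteq> {1..n} - A \<and> card B = d - card A}"
    by (rule bij_betw_same_card)
  also have "\<dots> = card ({1..n} - A) choose (d - card A)"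
    by (rule n_subsets) simp
  also have "card ({1..n} - A) = n - card A"
    using A fin by (simp add: card_Diff_subset)
  finally show ?thesis .
qed

lemma card_hyperedges: "card (hyperedges d n) = n choose d"
  using card_hyperedges_containing[of "{}" n d] by simp

text \<open>
  It suffices to count the hyperedges that meet \<open>S\<close> in exactly one vertex.
\<close>

lemma card_crossing_hyperedges_ge:
  assumes S: "S \<subseteq> {1..n}" and d: "2 \<le> d"
  shows "card S * ((n - card S) choose (d - 1)) \<le> card {e \<in> hyperedges d n. e \<inter> S \<noteq> {} \<and> \<not> e \<subseteq> S}"
proof -
  let ?B = "{B. B \<subseteq> {1..n} - S \<and> card B = d - 1}"
  have finS: "finite S" using S finite_subset by blast
  have "inj_on (\<lambda>(i, B). insert i B) (S \<times> ?B)"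
  proof (rule inj_onI, clarify)
    fix i B i' B' assume *: "i \<in> S" "B \<subseteq> {1..n} - S" "i' \<in> S" "B' \<subseteq> {1..n} - S" "insert i B = insert i' B'"
    then have "insert i B \<inter> S = {i}" "insert i' B' \<inter> S = {i'}" "insert i B - S = B" "insert i' B' - S = B'"
      by auto
    with *(5) show "i = i' \<and> B = B'" by auto
  qed
  moreover have "(\<lambda>(i, B). insert i B) ` (S \<times> ?B) \<subseteq> {e \<in> hyperedges d n. e \<inter> S \<noteq> {} \<and> \<not> e \<subseteq> S}"
  proof clarify
    fix i B assume *: "i \<in> S" "B \<subseteq> {1..n} - S" "card B = d - 1"
    then have "finite B" "B \<noteq> {}" "i \<notin> B" using d by (auto intro: finite_subset)
    then show "insert i B \<in> hyperedges d n \<and> insert i B \<inter> S \<noteq> {} \<and> \<not> insert i B \<subseteq> S"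
      using * S d by (auto simp: hyperedges_def)
  qed
  ultimately have "card (S \<times> ?B) \<le> card {e \<in> hyperedges d n. e \<inter> S \<noteq> {} \<and> \<not> e \<subseteq> S}"
    by (rule card_inj_on_le) simp
  moreover have "card ?B = (n - card S) choose (d - 1)"
    using n_subsets[of "{1..n} - S" "d - 1"] S finS by (simp add: card_Diff_subset)
  ultimately show ?thesis by (simp add: card_cartesian_product)
qed

text \<open>
  For \<open>n \<ge> 2 * d\<close>, a lower bound, uniform over \<open>S\<close> with at most \<open>n / 2\<close> vertices, for the number of hyperedges across \<open>S\<close>
  divided by the number \<open>|S| * ((n - 1) choose (d - 1))\<close> of pairs of a vertex of \<open>S\<close> and a hyperedge
  containing it.
\<close>

definition crossing_ratio :: "nat \<Rightarrow> real" where
  "crossing_ratio d = (1 / (2 * real (d - 1))) ^ (d - 1)"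

lemma binomial_ge_half_power:
  assumes d: "2 \<le> d" and m: "n \<le> 2 * m" "d - 1 \<le> m"
  shows "crossing_ratio d * real n ^ (d - 1) \<le> real (m choose (d - 1))"
proof -
  have "crossing_ratio d * real n ^ (d - 1) = (real n / (2 * real (d - 1))) ^ (d - 1)"
    by (simp add: crossing_ratio_def power_divide)
  also have "\<dots> \<le> (real m / real (d - 1)) ^ (d - 1)"
  proof (intro power_mono)
    have "real n / 2 / real (d - 1) \<le> real m / real (d - 1)"
      using m by (intro divide_right_mono) auto
    then show "real n / (2 * real (d - 1)) \<le> real m / real (d - 1)" by simp
  qed auto
  also have "\<dots> \<le> real (m choose (d - 1))"
    using m by (intro binomial_ge_n_over_k_pow_k)
  finally show ?thesis .
qed

lemma crossing_hyperedges_ge_ratio: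
  assumes S: "S \<subseteq> {1..n}" "2 * card S \<le> n" and d: "2 \<le> d" and n: "2 * d \<le> n"
  shows "crossing_ratio d * real ((n - 1) choose (d - 1)) * real (card S)
     \<le> real (card {e \<in> hyperedges d n. e \<inter> S \<noteq> {} \<and> \<not> e \<subseteq> S})"
proof -
  have "(n - 1) choose (d - 1) \<le> (n - 1) ^ (d - 1)"
    using n by (intro binomial_le_pow) auto
  also have "\<dots> \<le> n ^ (d - 1)" by (intro power_mono) auto
  finally have "crossing_ratio d * real ((n - 1) choose (d - 1)) \<le> crossing_ratio d * real n ^ (d - 1)"
    by (intro mult_left_mono) (auto simp: crossing_ratio_def simp flip: of_nat_power)
  also have "\<dots> \<le> real ((n - card S) choose (d - 1))"
    using S d n by (intro binomial_ge_half_power) auto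
  finally have "crossing_ratio d * real ((n - 1) choose (d - 1)) * real (card S)
      \<le> real ((n - card S) choose (d - 1)) * real (card S)"
    by (intro mult_right_mono) auto
  also have "\<dots> = real (card S * ((n - card S) choose (d - 1)))" by simp
  also have "\<dots> \<le> real (card {e \<in> hyperedges d n. e \<inter> S \<noteq> {} \<and> \<not> e \<subseteq> S})"
    using card_crossing_hyperedges_ge[OF S(1) d] by (simp only: of_nat_le_iff)
  finally show ?thesis .
qed

section \<open>Regular hypergraphs have the predicted hitting time\<close>

definition mean_degree :: "nat \<Rightarrow> nat \<Rightarrow> real \<Rightarrow> real" where
  "mean_degree d n p = p * real ((n - 1) choose (d - 1))"

definition crossing :: "nat set \<Rightarrow> nat set set \<Rightarrow> nat set set" where
  "crossing S E = {e \<in> E. e \<inter> S \<noteq> {} \<and> \<not> e \<subseteq> S}"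

text \<open>
  The typical properties that determine the hitting time of \<open>j\<close>, for mean degree \<open>D\<close>: expansion of
  sets with at most \<open>n / 2\<close> vertices, bounded degrees, precise values of the degree of \<open>j\<close> and of the number of edges, and
  small codegrees with \<open>j\<close>.
\<close>

definition regular :: "nat \<Rightarrow> nat \<Rightarrow> real \<Rightarrow> nat \<Rightarrow> real \<Rightarrow> real \<Rightarrow> nat set set \<Rightarrow> bool" where
  "regular d n D j \<eta> \<delta> E \<longleftrightarrow>
     (\<forall>S. S \<subseteq> {1..n} \<and> S \<noteq> {} \<and> 2 * card S \<le> n \<longrightarrow> crossing_ratio d * D * real (card S) / 2 < real (card (crossing S E))) \<and>
     (\<forall>i\<in>{1..n}. real (card {e \<in> E. i \<in> e}) < 2 * D) \<and>
     (1 - \<eta>) * D < real (card {e \<in> E. j \<in> e}) \<and> real (card {e \<in> E. j \<in> e}) < (1 + \<eta>) * D \<and>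
     (1 - \<eta>) * (real n * D / real d) < real (card E) \<and> real (card E) < (1 + \<eta>) * (real n * D / real d) \<and>
     (\<forall>i\<in>{1..n} - {j}. real (card {e \<in> E. i \<in> e \<and> j \<in> e}) < \<delta> * D)"

text \<open>
  The constant that Cheeger's inequality yields for a regular hypergraph. It depends only on \<open>d\<close>.
\<close>

definition gap_bound :: "nat \<Rightarrow> real" where
  "gap_bound d = (crossing_ratio d / (4 * real (d - 1)))\<^sup>2 / 32"

lemma crossing_ratio_pos: "2 \<le> d \<Longrightarrow> 0 < crossing_ratio d"
  by (auto simp: crossing_ratio_def intro!: zero_less_power)

lemma gap_bound_pos: "2 \<le> d \<Longrightarrow> 0 < gap_bound d"
  using crossing_ratio_pos[of d] by (simp add: gap_bound_def)

lemma vol_eq_card_edges: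
  assumes E: "E \<subseteq> hyperedges d n" and d: "2 \<le> d"
  shows "hypergraph.vol n E = real (d - 1) * (real d * real (card E))"
proof -
  have fin: "finite E" using E finite_hyperedges finite_subset by blast
  have "hypergraph.vol n E = (\<Sum>i\<in>{1..n}. real (d - 1) * real (card {e \<in> E. i \<in> e}))"
    by (simp add: hypergraph.vol_def deg_eq_walk_degree[OF E d] walk_degree_def)
  also have "\<dots> = real (d - 1) * real (\<Sum>i\<in>{1..n}. card {e \<in> E. i \<in> e})"
    by (simp add: sum_distrib_left)
  also have "(\<Sum>i\<in>{1..n}. card {e \<in> E. i \<in> e}) = (\<Sum>i\<in>{1..n}. \<Sum>e\<in>E. if i \<in> e then 1 else 0)"
    using fin by (simp add: sum.inter_filter[symmetric])
  also have "\<dots> = (\<Sum>e\<in>E. \<Sum>i\<in>{1..n}. if i \<in> e then 1 else 0)" by (rule sum.swap)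
  also have "\<dots> = (\<Sum>e\<in>E. d)"
  proof (rule sum.cong[OF refl])
    fix e assume "e \<in> E"
    then have e: "e \<subseteq> {1..n}" "card e = d" using E by (auto simp: hyperedges_def)
    then have "{i \<in> {1..n}. i \<in> e} = e" by auto
    then show "(\<Sum>i\<in>{1..n}. if i \<in> e then 1 else 0) = d"
      using e by (subst sum.inter_filter[symmetric]) auto
  qed
  finally show ?thesis by simp
qed

text \<open>
  Expansion of singletons already bounds the degrees from below. With the upper bound on the degrees,
  all degrees are of order \<open>D\<close>, so that the cut bound gives a constant gap and the codegree bound a
  small one-step probability of moving to \<open>j\<close>.
\<close>

lemma regular_implies:
  assumes E: "E \<subseteq> hyperedges d n" and d: "2 \<le> d" and n: "2 \<le> n" and j: "j \<in> {1..n}"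
    and D: "0 < D" and \<eta>: "0 \<le> \<eta>" "\<eta> < 1" and \<delta>: "0 \<le> \<delta>"
    and reg: "regular d n D j \<eta> \<delta> E"
  shows "connected_hypergraph n E"
    and "ennreal ((1 - \<eta>) / (1 + \<eta>) * real n - 2) \<le> average_target_hitting_time d n E j"
    and "average_target_hitting_time d n E j
      \<le> ennreal ((1 + \<eta>) / (1 - \<eta>) * real n * (1 + 2 * \<delta> / (real (d - 1) * crossing_ratio d) / gap_bound d))"
proof -
  let ?deg = "hypergraph.deg n E" and ?\<gamma> = "crossing_ratio d"
  have \<gamma>: "0 < ?\<gamma>" by (rule crossing_ratio_pos[OF d])
  have d1: "0 < real (d - 1)" using d by simp
  note deg = deg_eq_walk_degree[OF E d]
  have deg': "?deg i = real (d - 1) * real (card {e \<in> E. i \<in> e})" for i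
    by (simp add: deg walk_degree_def)
  have cross: "?\<gamma> * D * real (card S) / 2 < real (card (crossing S E))"
    if "S \<subseteq> {1..n}" "S \<noteq> {}" "2 * card S \<le> n" for S
    using reg that by (auto simp: regular_def)
  have small_or: "2 * card S \<le> n \<or> 2 * card ({1..n} - S) \<le> n" if "S \<subseteq> {1..n}" for S
    using that by (auto simp: card_Diff_subset finite_subset)
  have cutS: "?\<gamma> * D / (2 * real n) * card S * card ({1..n} - S) \<le> hypergraph.cut n E S"
    if S: "S \<subseteq> {1..n}" "2 * card S \<le> n" for S
  proof (cases "S = {}")
    case False
    have "?\<gamma> * D / (2 * real n) * card S * card ({1..n} - S) \<le> ?\<gamma> * D / (2 * real n) * card S * real n"
      using \<gamma> D card_mono[of "{1..n}" "{1..n} - S"] by (intro mult_left_mono) auto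
    also have "\<dots> = ?\<gamma> * D * real (card S) / 2" using n by simp
    also have "\<dots> \<le> hypergraph.cut n E S"
      using cross[OF S(1) False S(2)] card_crossing_le_cut[OF E d S(1)] by (simp add: crossing_def)
    finally show ?thesis .
  qed (simp add: hypergraph.cut_def)
  have cut: "?\<gamma> * D / (2 * real n) * card S * card ({1..n} - S) \<le> hypergraph.cut n E S"
    if S: "S \<subseteq> {1..n}" for S
    using small_or[OF S]
  proof
    assume "2 * card ({1..n} - S) \<le> n"
    then have "?\<gamma> * D / (2 * real n) * card ({1..n} - S) * card ({1..n} - ({1..n} - S))
        \<le> hypergraph.cut n E ({1..n} - S)" by (intro cutS) auto
    also have "{1..n} - ({1..n} - S) = S" using S by auto
    finally show ?thesis using hypergraph.cut_complement[OF S] by (simp only: mult_ac)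
  qed (use S cutS in blast)
  have deg_ge: "real (d - 1) * (?\<gamma> * D / 2) \<le> ?deg i" if i: "i \<in> {1..n}" for i
  proof -
    have "?\<gamma> * D / 2 < real (card (crossing {i} E))" using cross[of "{i}"] i n by simp
    also have "\<dots> \<le> real (card {e \<in> E. i \<in> e})"
      using finite_edge_set[OF E d] by (intro of_nat_mono card_mono) (auto simp: crossing_def)
    finally show ?thesis unfolding deg' using d1 by (intro mult_left_mono) auto
  qed
  have deg_pos: "0 < ?deg i" if "i \<in> {1..n}" for i
    using deg_ge[OF that] mult_pos_pos[OF d1, of "?\<gamma> * D / 2"] mult_pos_pos[OF \<gamma> D] by linarith
  have deg_le: "?deg i \<le> real (d - 1) * (2 * D)" if "i \<in> {1..n}" for i
    unfolding deg' using reg that d1 by (intro mult_left_mono) (auto simp: regular_def less_imp_le)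
  have gap: "gap_bound d * (\<Sum>i\<in>{1..n}. ?deg i * (f i)\<^sup>2) \<le> hypergraph.energy n E f"
    if "(\<Sum>i\<in>{1..n}. ?deg i * f i) = 0" for f
  proof -
    have "?\<gamma> * D / (2 * real n) * real (card {1..n}) / (real (d - 1) * (2 * D)) = ?\<gamma> / (4 * real (d - 1))"
      using n D by (simp add: field_simps)
    then show ?thesis
      using hypergraph.poincare_of_cut[of n "?\<gamma> * D / (2 * real n)" E "real (d - 1) * (2 * D)" f]
        cut deg_le that D d1 \<gamma> unfolding gap_bound_def by simp
  qed
  show "connected_hypergraph n E"
  proof (rule connected_of_crossing[OF E d])
    fix S assume S: "S \<subseteq> {1..n}" "S \<noteq> {}" "S \<noteq> {1..n}"
    have pos: "crossing T E \<noteq> {}" if "T \<subseteq> {1..n}" "T \<noteq> {}" "2 * card T \<le> n" for T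
    proof
      assume "crossing T E = {}"
      then have "?\<gamma> * D * real (card T) / 2 < 0" using cross[OF that] by simp
      moreover have "0 \<le> ?\<gamma> * D * real (card T) / 2" using \<gamma> D by simp
      ultimately show False by simp
    qed
    from small_or[OF S(1)] show "\<exists>e\<in>E. e \<inter> S \<noteq> {} \<and> \<not> e \<subseteq> S"
    proof
      assume "2 * card ({1..n} - S) \<le> n"
      then obtain e where e: "e \<in> E" "e \<inter> ({1..n} - S) \<noteq> {}" "\<not> e \<subseteq> {1..n} - S"
        using pos[of "{1..n} - S"] S by (auto simp: crossing_def)
      moreover have "e \<subseteq> {1..n}" using edge_subset_card[OF E d e(1)] by simp
      ultimately show ?thesis by (intro bexI[of _ e]) auto
    qed (use pos[OF S(1,2)] in \<open>auto simp: crossing_def\<close>)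
  qed
  have ret: "codegree E i j \<le> 2 * \<delta> / (real (d - 1) * ?\<gamma>) * ?deg i" if i: "i \<in> {1..n}" for i
  proof -
    have "codegree E i j \<le> \<delta> * D"
      using reg i D \<delta> by (auto simp: regular_def codegree_def less_imp_le)
    also have "\<dots> = 2 * \<delta> / (real (d - 1) * ?\<gamma>) * (real (d - 1) * (?\<gamma> * D / 2))"
      using \<gamma> d1 by simp
    also have "\<dots> \<le> 2 * \<delta> / (real (d - 1) * ?\<gamma>) * ?deg i"
      using deg_ge[OF i] \<gamma> d1 \<delta> by (intro mult_left_mono) auto
    finally show ?thesis .
  qed
  define c where "c = real (card {e \<in> E. j \<in> e})"
  have ratio: "hypergraph.vol n E / ?deg j = real d * real (card E) / c"
    using d1 by (simp add: vol_eq_card_edges[OF E d] deg' c_def)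
  have c: "(1 - \<eta>) * D < c" "c < (1 + \<eta>) * D" using reg by (auto simp: regular_def c_def)
  have c0: "0 < c" using c(1) D \<eta> by (smt (verit) mult_pos_pos)
  have M: "(1 - \<eta>) * (real n * D) \<le> real d * real (card E)" "real d * real (card E) \<le> (1 + \<eta>) * (real n * D)"
    using reg d by (auto simp: regular_def field_simps)
  note bounds = average_target_hitting_time_bounds[OF E d j deg_pos gap_bound_pos[OF d] gap ret]
  have "(1 - \<eta>) / (1 + \<eta>) * real n = (1 - \<eta>) * (real n * D) / ((1 + \<eta>) * D)"
    using D by (simp add: mult.assoc[symmetric])
  also have "\<dots> \<le> real d * real (card E) / c"
    using M c c0 D \<eta> by (intro frac_le) auto
  finally have "(1 - \<eta>) / (1 + \<eta>) * real n - 2 \<le> hypergraph.vol n E / ?deg j - 2" by (simp add: ratio)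
  then show "ennreal ((1 - \<eta>) / (1 + \<eta>) * real n - 2) \<le> average_target_hitting_time d n E j"
    using bounds(1) by (meson ennreal_leI order.trans)
  have "real d * real (card E) / c \<le> (1 + \<eta>) * (real n * D) / ((1 - \<eta>) * D)"
    using M c c0 D \<eta> by (intro frac_le) auto
  also have "\<dots> = (1 + \<eta>) / (1 - \<eta>) * real n"
    using D by (simp add: mult.assoc[symmetric])
  finally have "hypergraph.vol n E / ?deg j * (1 + 2 * \<delta> / (real (d - 1) * ?\<gamma>) / gap_bound d)
      \<le> (1 + \<eta>) / (1 - \<eta>) * real n * (1 + 2 * \<delta> / (real (d - 1) * ?\<gamma>) / gap_bound d)"
    using \<delta> d1 \<gamma> gap_bound_pos[OF d]
    unfolding ratio by (intro mult_right_mono add_nonneg_nonneg divide_nonneg_nonneg) auto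
  then show "average_target_hitting_time d n E j
      \<le> ennreal ((1 + \<eta>) / (1 - \<eta>) * real n * (1 + 2 * \<delta> / (real (d - 1) * ?\<gamma>) / gap_bound d))"
    using bounds(2) by (meson ennreal_leI order.trans)
qed

section \<open>The random hypergraph is regular with high probability\<close>

lemma codegree_count_identity:
  assumes d: "2 \<le> d" "d \<le> n"
  shows "real (n - 1) * real ((n - 2) choose (d - 2)) = real (d - 1) * real ((n - 1) choose (d - 1))"
proof -
  have "Suc (d - 2) * (Suc (n - 2) choose Suc (d - 2)) = Suc (n - 2) * ((n - 2) choose (d - 2))"
    using Suc_times_binomial_eq[of "n - 2" "d - 2"] by (simp only: mult.commute)
  moreover have "Suc (d - 2) = d - 1" "Suc (n - 2) = n - 1" using d by auto
  ultimately have "(d - 1) * ((n - 1) choose (d - 1)) = (n - 1) * ((n - 2) choose (d - 2))" by simp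
  then show ?thesis by (metis of_nat_mult)
qed

lemma edge_count_identity:
  assumes d: "2 \<le> d" "d \<le> n"
  shows "real d * real (n choose d) = real n * real ((n - 1) choose (d - 1))"
proof -
  have "d * (n choose d) = n * ((n - 1) choose (d - 1))"
    using d by (intro times_binomial_minus1_eq) auto
  then show ?thesis by (metis of_nat_mult)
qed

lemma sum_power_card_Pow:
  fixes q :: real
  assumes "finite V"
  shows "(\<Sum>S\<in>Pow V. q ^ card S) = (1 + q) ^ card V"
  using prod_add[OF assms, of "\<lambda>_. q" "\<lambda>_. 1"] by (simp add: add.commute)

context
  fixes d n :: nat and p :: real
  assumes p: "0 < p" "p < 1" and d: "2 \<le> d" and n: "2 * d \<le> n"
begin

lemma p_bounds: "0 \<le> p" "p \<le> 1" using p by auto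

lemma mean_degree_pos: "0 < mean_degree d n p"
  using p d n by (auto simp: mean_degree_def intro!: mult_pos_pos)

text \<open>
  A union bound over \<open>S\<close>. The failure probability for \<open>S\<close> is at most \<open>q ^ card S\<close> with \<open>q\<close> exponentially
  small in the mean degree, and these numbers sum to \<open>(1 + q) ^ n - 1\<close> over the nonempty sets.
\<close>

lemma prob_sparse_cut:
  "measure_pmf.prob (random_hypergraph d n p) {E. \<exists>S. S \<subseteq> {1..n} \<and> S \<noteq> {} \<and> 2 * card S \<le> n \<and>
      real (card (E \<inter> crossing S (hyperedges d n))) \<le> crossing_ratio d * mean_degree d n p * real (card S) / 2}
    \<le> exp (real n * exp (- (crossing_ratio d * mean_degree d n p / 16))) - 1"
proof -
  let ?V = "{1..n}" and ?\<gamma> = "crossing_ratio d"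
  let ?bad = "\<lambda>S. {E. real (card (E \<inter> crossing S (hyperedges d n))) \<le> ?\<gamma> * mean_degree d n p * real (card S) / 2}"
  let ?\<S> = "{S. S \<subseteq> ?V \<and> S \<noteq> {} \<and> 2 * card S \<le> n}"
  define q where "q = exp (- (?\<gamma> * mean_degree d n p / 16))"
  have fin: "finite ?\<S>" by (rule finite_subset[of _ "Pow ?V"]) auto
  have "{E. \<exists>S. S \<subseteq> ?V \<and> S \<noteq> {} \<and> 2 * card S \<le> n \<and>
      real (card (E \<inter> crossing S (hyperedges d n))) \<le> ?\<gamma> * mean_degree d n p * real (card S) / 2} = (\<Union>S\<in>?\<S>. ?bad S)"
    by auto
  then have "measure_pmf.prob (random_hypergraph d n p) {E. \<exists>S. S \<subseteq> ?V \<and> S \<noteq> {} \<and> 2 * card S \<le> n \<and>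
      real (card (E \<inter> crossing S (hyperedges d n))) \<le> ?\<gamma> * mean_degree d n p * real (card S) / 2}
    \<le> (\<Sum>S\<in>?\<S>. measure_pmf.prob (random_hypergraph d n p) (?bad S))"
    using fin measure_pmf.finite_measure_subadditive_finite[of ?\<S> ?bad "random_hypergraph d n p"] by simp
  also have "\<dots> \<le> (\<Sum>S\<in>?\<S>. q ^ card S)"
  proof (rule sum_mono)
    fix S assume S: "S \<in> ?\<S>"
    let ?m = "?\<gamma> * mean_degree d n p * real (card S)"
    have F: "crossing S (hyperedges d n) \<subseteq> hyperedges d n" by (auto simp: crossing_def)
    have "p * (?\<gamma> * real ((n - 1) choose (d - 1)) * real (card S)) \<le> p * real (card (crossing S (hyperedges d n)))"
      unfolding crossing_def using S d n p by (intro mult_left_mono crossing_hyperedges_ge_ratio) auto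
    then have m: "?m \<le> p * real (card (crossing S (hyperedges d n)))" by (simp add: mean_degree_def mult_ac)
    have "measure_pmf.prob (random_hypergraph d n p) (?bad S) \<le> exp (- (?m * (1/2)\<^sup>2 / 4))"
      using edge_count_lower_tail[OF p_bounds F m, of "1/2"] by simp
    also have "\<dots> = q ^ card S"
      by (simp add: q_def exp_of_nat_mult[symmetric] power2_eq_square field_simps)
    finally show "measure_pmf.prob (random_hypergraph d n p) (?bad S) \<le> q ^ card S" .
  qed
  also have "\<dots> \<le> (\<Sum>S\<in>Pow ?V - {{}}. q ^ card S)"
    by (rule sum_mono2) (auto simp: q_def)
  also have "\<dots> = (1 + q) ^ n - 1"
    using sum_power_card_Pow[of ?V q] by (simp add: sum_diff1)
  also have "\<dots> \<le> exp q ^ n - 1"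
    by (intro diff_right_mono power_mono exp_ge_add_one_self) (simp add: q_def)
  also have "\<dots> = exp (real n * q) - 1" by (simp add: exp_of_nat_mult)
  finally show ?thesis unfolding q_def .
qed

lemma prob_degree_large:
  "measure_pmf.prob (random_hypergraph d n p) {E. \<exists>i\<in>{1..n}. 2 * mean_degree d n p \<le> real (card (E \<inter> {e \<in> hyperedges d n. i \<in> e}))}
    \<le> real n * exp (- (mean_degree d n p / 4))"
proof -
  let ?F = "\<lambda>i. {e \<in> hyperedges d n. i \<in> e}"
  have mean: "p * real (card (?F i)) = mean_degree d n p" if "i \<in> {1..n}" for i
    using card_hyperedges_containing[of "{i}" n d] that d by (simp add: mean_degree_def One_nat_def)
  have "measure_pmf.prob (random_hypergraph d n p) {E. \<exists>i\<in>{1..n}. 2 * mean_degree d n p \<le> real (card (E \<inter> ?F i))}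
      = measure_pmf.prob (random_hypergraph d n p) (\<Union>i\<in>{1..n}. {E. 2 * mean_degree d n p \<le> real (card (E \<inter> ?F i))})"
    by (rule arg_cong[where f="measure_pmf.prob (random_hypergraph d n p)"]) auto
  also have "\<dots> \<le> (\<Sum>i\<in>{1..n}. measure_pmf.prob (random_hypergraph d n p) {E. 2 * mean_degree d n p \<le> real (card (E \<inter> ?F i))})"
    by (rule measure_pmf.finite_measure_subadditive_finite) auto
  also have "\<dots> \<le> (\<Sum>i\<in>{1..n}. exp (- (mean_degree d n p / 4)))"
  proof (rule sum_mono)
    fix i assume i: "i \<in> {1..n}"
    show "measure_pmf.prob (random_hypergraph d n p) {E. 2 * mean_degree d n p \<le> real (card (E \<inter> ?F i))} \<le> exp (- (mean_degree d n p / 4))"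
      using edge_count_upper_tail[OF p_bounds, of "?F i" d n 1] mean[OF i] by simp
  qed
  finally show ?thesis by simp
qed

text \<open>
  The mean codegree is smaller than the mean degree by a factor of order \<open>1 / n\<close>, so for large \<open>n\<close> the
  event is a large deviation and the crude Chernoff bound with \<open>t = 1\<close> is enough.
\<close>

lemma prob_codegree_large:
  assumes j: "j \<in> {1..n}" and \<delta>: "4 * real (d - 1) \<le> \<delta> * real (n - 1)"
  shows "measure_pmf.prob (random_hypergraph d n p) {E. \<exists>i\<in>{1..n} - {j}. \<delta> * mean_degree d n p \<le> real (card (E \<inter> {e \<in> hyperedges d n. i \<in> e \<and> j \<in> e}))}
    \<le> real n * exp (- (\<delta> * mean_degree d n p / 2))"
proof -
  let ?F = "\<lambda>i. {e \<in> hyperedges d n. i \<in> e \<and> j \<in> e}"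
  have \<mu>: "2 * (p * real (card (?F i))) \<le> \<delta> * mean_degree d n p / 2" if i: "i \<in> {1..n} - {j}" for i
  proof -
    have "card (?F i) = (n - 2) choose (d - 2)"
      using card_hyperedges_containing[of "{i, j}" n d] i j d by (simp add: numeral_2_eq_2)
    then have "real (n - 1) * (2 * (p * real (card (?F i)))) = p * 2 * (real (n - 1) * real ((n - 2) choose (d - 2)))"
      by simp
    also have "\<dots> = p * 2 * (real (d - 1) * real ((n - 1) choose (d - 1)))"
      using codegree_count_identity[of d n] d n by simp
    also have "\<dots> = 4 * real (d - 1) * (mean_degree d n p / 2)" by (simp add: mean_degree_def)
    also have "\<dots> \<le> \<delta> * real (n - 1) * (mean_degree d n p / 2)"
      using \<delta> mean_degree_pos by (intro mult_right_mono) auto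
    finally have "real (n - 1) * (2 * (p * real (card (?F i)))) \<le> real (n - 1) * (\<delta> * mean_degree d n p / 2)"
      by (simp add: mult_ac)
    moreover have "0 < real (n - 1)" using n d by simp
    ultimately show ?thesis by (simp only: mult_le_cancel_left_pos)
  qed
  have "measure_pmf.prob (random_hypergraph d n p) {E. \<exists>i\<in>{1..n} - {j}. \<delta> * mean_degree d n p \<le> real (card (E \<inter> ?F i))}
      = measure_pmf.prob (random_hypergraph d n p) (\<Union>i\<in>{1..n} - {j}. {E. \<delta> * mean_degree d n p \<le> real (card (E \<inter> ?F i))})"
    by (rule arg_cong[where f="measure_pmf.prob (random_hypergraph d n p)"]) auto
  also have "\<dots> \<le> (\<Sum>i\<in>{1..n} - {j}. measure_pmf.prob (random_hypergraph d n p) {E. \<delta> * mean_degree d n p \<le> real (card (E \<inter> ?F i))})"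
    by (rule measure_pmf.finite_measure_subadditive_finite) auto
  also have "\<dots> \<le> (\<Sum>i\<in>{1..n} - {j}. exp (- (\<delta> * mean_degree d n p / 2)))"
  proof (rule sum_mono)
    fix i assume i: "i \<in> {1..n} - {j}"
    have "measure_pmf.prob (random_hypergraph d n p) {E. \<delta> * mean_degree d n p \<le> real (card (E \<inter> ?F i))} \<le> exp (2 * (p * real (card (?F i))) - \<delta> * mean_degree d n p)"
      by (rule edge_count_large_deviation[OF p_bounds]) auto
    also have "\<dots> \<le> exp (- (\<delta> * mean_degree d n p / 2))" using \<mu>[OF i] by simp
    finally show "measure_pmf.prob (random_hypergraph d n p) {E. \<delta> * mean_degree d n p \<le> real (card (E \<inter> ?F i))} \<le> exp (- (\<delta> * mean_degree d n p / 2))" .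
  qed
  also have "\<dots> \<le> (\<Sum>i\<in>{1..n}. exp (- (\<delta> * mean_degree d n p / 2)))" by (rule sum_mono2) auto
  finally show ?thesis by simp
qed

lemma prob_count_deviates:
  assumes F: "F \<subseteq> hyperedges d n" and \<eta>: "0 \<le> \<eta>" "\<eta> \<le> 1"
  shows "measure_pmf.prob (random_hypergraph d n p) {E. real (card (E \<inter> F)) \<le> (1 - \<eta>) * (p * real (card F)) \<or>
       (1 + \<eta>) * (p * real (card F)) \<le> real (card (E \<inter> F))} \<le> 2 * exp (- (p * real (card F) * \<eta>\<^sup>2 / 4))"
proof -
  let ?\<mu> = "p * real (card F)"
  have "{E. real (card (E \<inter> F)) \<le> (1 - \<eta>) * ?\<mu> \<or> (1 + \<eta>) * ?\<mu> \<le> real (card (E \<inter> F))}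
     = {E. real (card (E \<inter> F)) \<le> (1 - \<eta>) * ?\<mu>} \<union> {E. (1 + \<eta>) * ?\<mu> \<le> real (card (E \<inter> F))}" by auto
  then have "measure_pmf.prob (random_hypergraph d n p) {E. real (card (E \<inter> F)) \<le> (1 - \<eta>) * ?\<mu> \<or> (1 + \<eta>) * ?\<mu> \<le> real (card (E \<inter> F))}
      \<le> measure_pmf.prob (random_hypergraph d n p) {E. real (card (E \<inter> F)) \<le> (1 - \<eta>) * ?\<mu>}
        + measure_pmf.prob (random_hypergraph d n p) {E. (1 + \<eta>) * ?\<mu> \<le> real (card (E \<inter> F))}"
    by (simp add: measure_Un_le)
  also have "\<dots> \<le> exp (- (?\<mu> * \<eta>\<^sup>2 / 4)) + exp (- (?\<mu> * \<eta>\<^sup>2 / 4))"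
    using \<eta> by (intro add_mono edge_count_lower_tail[OF p_bounds F order.refl] edge_count_upper_tail[OF p_bounds F]) auto
  finally show ?thesis by simp
qed

lemma prob_regular_ge:
  assumes j: "j \<in> {1..n}" and \<eta>: "0 \<le> \<eta>" "\<eta> \<le> 1" and \<delta>: "4 * real (d - 1) \<le> \<delta> * real (n - 1)"
  shows "1 - (exp (real n * exp (- (crossing_ratio d * mean_degree d n p / 16))) - 1 + real n * exp (- (mean_degree d n p / 4))
      + 4 * exp (- (mean_degree d n p * \<eta>\<^sup>2 / 4)) + real n * exp (- (\<delta> * mean_degree d n p / 2)))
    \<le> measure_pmf.prob (random_hypergraph d n p) {E. E \<subseteq> hyperedges d n \<and> regular d n (mean_degree d n p) j \<eta> \<delta> E}"
proof -
  let ?HE = "hyperedges d n"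
  define A1 where "A1 = {E. \<exists>S. S \<subseteq> {1..n} \<and> S \<noteq> {} \<and> 2 * card S \<le> n \<and>
      real (card (E \<inter> crossing S ?HE)) \<le> crossing_ratio d * mean_degree d n p * real (card S) / 2}"
  define A2 where "A2 = {E. \<exists>i\<in>{1..n}. 2 * mean_degree d n p \<le> real (card (E \<inter> {e \<in> ?HE. i \<in> e}))}"
  define A3 where "A3 = {E. real (card (E \<inter> {e \<in> ?HE. j \<in> e})) \<le> (1 - \<eta>) * (p * real (card {e \<in> ?HE. j \<in> e})) \<or>
       (1 + \<eta>) * (p * real (card {e \<in> ?HE. j \<in> e})) \<le> real (card (E \<inter> {e \<in> ?HE. j \<in> e}))}"
  define A4 where "A4 = {E. real (card (E \<inter> ?HE)) \<le> (1 - \<eta>) * (p * real (card ?HE)) \<or>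
       (1 + \<eta>) * (p * real (card ?HE)) \<le> real (card (E \<inter> ?HE))}"
  define A5 where "A5 = {E. \<exists>i\<in>{1..n} - {j}. \<delta> * mean_degree d n p \<le> real (card (E \<inter> {e \<in> ?HE. i \<in> e \<and> j \<in> e}))}"
  have mj: "p * real (card {e \<in> ?HE. j \<in> e}) = mean_degree d n p"
    using card_hyperedges_containing[of "{j}" n d] j d by (simp add: mean_degree_def One_nat_def)
  have "real d * (p * real (card ?HE)) = p * (real d * real (n choose d))"
    by (simp add: card_hyperedges)
  also have "\<dots> = real n * mean_degree d n p" using edge_count_identity[of d n] d n by (simp add: mean_degree_def)
  finally have me: "p * real (card ?HE) = real n * mean_degree d n p / real d" using d by (simp add: field_simps)
  have "mean_degree d n p \<le> p * real (card ?HE)"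
    using mean_degree_pos n d unfolding me by (simp add: field_simps)
  then have e4: "exp (- (p * real (card ?HE) * \<eta>\<^sup>2 / 4)) \<le> exp (- (mean_degree d n p * \<eta>\<^sup>2 / 4))"
    by (simp add: mult_right_mono)
  have sub: "E \<in> {E. E \<subseteq> ?HE \<and> regular d n (mean_degree d n p) j \<eta> \<delta> E}"
    if "E \<subseteq> ?HE" "E \<notin> A1 \<union> A2 \<union> A3 \<union> A4 \<union> A5" for E
  proof -
    have int: "E \<inter> {e \<in> ?HE. Q e} = {e \<in> E. Q e}" for Q using that(1) by auto
    have int': "E \<inter> crossing S ?HE = crossing S E" for S using that(1) by (auto simp: crossing_def)
    have "E \<inter> ?HE = E" using that(1) by auto
    have n1: "E \<notin> A1" and n2: "E \<notin> A2" and n3: "E \<notin> A3" and n4: "E \<notin> A4" and n5: "E \<notin> A5"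
      using that(2) by blast+
    show ?thesis
      unfolding mem_Collect_eq regular_def
    proof (intro conjI)
      show "\<forall>S. S \<subseteq> {1..n} \<and> S \<noteq> {} \<and> 2 * card S \<le> n \<longrightarrow>
          crossing_ratio d * mean_degree d n p * real (card S) / 2 < real (card (crossing S E))"
        using n1 unfolding A1_def mem_Collect_eq int' not_le[symmetric] by blast
      show "\<forall>i\<in>{1..n}. real (card {e \<in> E. i \<in> e}) < 2 * mean_degree d n p"
        using n2 unfolding A2_def mem_Collect_eq int not_le[symmetric] by blast
      show "(1 - \<eta>) * mean_degree d n p < real (card {e \<in> E. j \<in> e})" "real (card {e \<in> E. j \<in> e}) < (1 + \<eta>) * mean_degree d n p"
        using n3 unfolding A3_def mem_Collect_eq mj int not_le[symmetric] by blast+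
      show "(1 - \<eta>) * (real n * mean_degree d n p / real d) < real (card E)" "real (card E) < (1 + \<eta>) * (real n * mean_degree d n p / real d)"
        using n4 unfolding A4_def mem_Collect_eq me \<open>E \<inter> ?HE = E\<close> not_le[symmetric] by blast+
      show "\<forall>i\<in>{1..n} - {j}. real (card {e \<in> E. i \<in> e \<and> j \<in> e}) < \<delta> * mean_degree d n p"
        using n5 unfolding A5_def mem_Collect_eq int not_le[symmetric] by blast
    qed (rule that(1))
  qed
  have "measure_pmf.prob (random_hypergraph d n p) (A1 \<union> A2 \<union> A3 \<union> A4 \<union> A5)
      \<le> measure_pmf.prob (random_hypergraph d n p) A1 + measure_pmf.prob (random_hypergraph d n p) A2 + measure_pmf.prob (random_hypergraph d n p) A3 + measure_pmf.prob (random_hypergraph d n p) A4 + measure_pmf.prob (random_hypergraph d n p) A5"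
  proof -
    have un: "measure_pmf.prob (random_hypergraph d n p) (X \<union> Y) \<le> measure_pmf.prob (random_hypergraph d n p) X + measure_pmf.prob (random_hypergraph d n p) Y" for X Y
      by (rule measure_Un_le) auto
    show ?thesis
      using un[of "A1 \<union> A2 \<union> A3 \<union> A4" A5] un[of "A1 \<union> A2 \<union> A3" A4] un[of "A1 \<union> A2" A3] un[of A1 A2]
      by linarith
  qed
  also have "\<dots> \<le> (exp (real n * exp (- (crossing_ratio d * mean_degree d n p / 16))) - 1) + real n * exp (- (mean_degree d n p / 4))
      + 2 * exp (- (mean_degree d n p * \<eta>\<^sup>2 / 4)) + 2 * exp (- (mean_degree d n p * \<eta>\<^sup>2 / 4)) + real n * exp (- (\<delta> * mean_degree d n p / 2))"
  proof (intro add_mono)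
    show "measure_pmf.prob (random_hypergraph d n p) A3 \<le> 2 * exp (- (mean_degree d n p * \<eta>\<^sup>2 / 4))"
      using prob_count_deviates[of "{e \<in> ?HE. j \<in> e}", OF _ \<eta>] unfolding A3_def mj by auto
    show "measure_pmf.prob (random_hypergraph d n p) A4 \<le> 2 * exp (- (mean_degree d n p * \<eta>\<^sup>2 / 4))"
      using prob_count_deviates[OF order.refl \<eta>] e4 unfolding A4_def by linarith
  qed (use prob_sparse_cut prob_degree_large prob_codegree_large[OF j \<delta>] in \<open>simp_all add: A1_def A2_def A5_def\<close>)
  finally have bad: "measure_pmf.prob (random_hypergraph d n p) (A1 \<union> A2 \<union> A3 \<union> A4 \<union> A5) \<le> \<dots>" .
  have "1 - measure_pmf.prob (random_hypergraph d n p) (A1 \<union> A2 \<union> A3 \<union> A4 \<union> A5) = measure_pmf.prob (random_hypergraph d n p) (- (A1 \<union> A2 \<union> A3 \<union> A4 \<union> A5))"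
    using measure_pmf.prob_compl[of "A1 \<union> A2 \<union> A3 \<union> A4 \<union> A5" "random_hypergraph d n p"] by (simp add: Compl_eq_Diff_UNIV)
  also have "\<dots> \<le> measure_pmf.prob (random_hypergraph d n p) {E. E \<subseteq> ?HE \<and> regular d n (mean_degree d n p) j \<eta> \<delta> E}"
  proof (rule measure_pmf.finite_measure_mono_AE)
    show "AE E in random_hypergraph d n p. E \<in> - (A1 \<union> A2 \<union> A3 \<union> A4 \<union> A5) \<longrightarrow> E \<in> {E. E \<subseteq> ?HE \<and> regular d n (mean_degree d n p) j \<eta> \<delta> E}"
      using set_random_hypergraph[of d n p] sub by (intro AE_pmfI) blast
  qed simp
  finally show ?thesis using bad by linarith
qed

end

text \<open>
  If an event implies the condition, conditioning can only increase the probability. This is how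
  conditioning on connectedness is removed; it is also correct when the condition has probability
  \<open>0\<close>, where the conditional probability is \<open>0\<close> by convention.
\<close>

lemma cond_prob_ge_prob:
  fixes M :: "'a pmf"
  assumes "\<And>x. x \<in> G \<Longrightarrow> A x \<and> C x"
  shows "measure_pmf.prob M G \<le> \<P>(x in M. A x \<bar> C x)"
proof -
  have G: "measure_pmf.prob M G \<le> \<P>(x in M. A x \<and> C x)"
    using assms by (intro measure_pmf.finite_measure_mono) auto
  also have "\<dots> \<le> \<P>(x in M. A x \<bar> C x)"
  proof (cases "\<P>(x in M. C x) = 0")
    case True
    have "\<P>(x in M. A x \<and> C x) \<le> \<P>(x in M. C x)"
      by (intro measure_pmf.finite_measure_mono) auto
    also have "\<dots> = \<P>(x in M. A x \<bar> C x)" unfolding cond_prob_def True by simp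
    finally show ?thesis .
  next
    case False
    then have "0 < \<P>(x in M. C x)" "\<P>(x in M. C x) \<le> 1"
      by (auto simp: zero_less_measure_iff)
    then show ?thesis
      unfolding cond_prob_def by (simp add: pos_le_divide_eq mult_left_le)
  qed
  finally show ?thesis .
qed

lemma divide_le_1_of_le: "a \<le> b \<Longrightarrow> 0 \<le> b \<Longrightarrow> a / b \<le> (1::real)"
  by (cases "b = 0") (auto simp: divide_le_eq_1)

lemma cond_prob_le_1: "\<P>(x in measure_pmf M. A x \<bar> C x) \<le> 1"
proof -
  have "\<P>(x in M. A x \<and> C x) \<le> \<P>(x in M. C x)"
    by (intro measure_pmf.finite_measure_mono) auto
  moreover have "0 \<le> \<P>(x in M. C x)" by simp
  ultimately show ?thesis unfolding cond_prob_def by (rule divide_le_1_of_le)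
qed

section \<open>The limit theorem\<close>

text \<open>
  The mean degree is of order \<open>p n * n ^ (d - 1)\<close>, which dominates the logarithm by the hypothesis.
\<close>

lemma ln_over_mean_degree_tendsto_0:
  assumes d: "2 \<le> d"
    and p: "\<And>n. n \<ge> 1 \<Longrightarrow> 0 < p n \<and> p n < 1"
    and growth: "(\<lambda>n. ((ln (real n)) ^ 4 / real n ^ (d - 1)) / (p n * (1 - p n))) \<longlonglongrightarrow> 0"
  shows "(\<lambda>n. ln (real n) / mean_degree d n (p n)) \<longlonglongrightarrow> 0"
proof (rule tendsto_sandwich[OF _ _ tendsto_const])
  let ?\<gamma> = "crossing_ratio d"
  let ?q = "\<lambda>n. ((ln (real n)) ^ 4 / real n ^ (d - 1)) / (p n * (1 - p n))"
  have \<gamma>: "0 < ?\<gamma>" using d by (rule crossing_ratio_pos)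
  show "(\<lambda>n. 1 / ?\<gamma> * ?q n) \<longlonglongrightarrow> 0"
    using tendsto_mult[OF tendsto_const growth, of "1 / ?\<gamma>"] by simp
  have pos: "0 < mean_degree d n (p n)" if "2 * d \<le> n" for n
    using that d p[of n] by (intro mean_degree_pos) auto
  show "\<forall>\<^sub>F n in sequentially. 0 \<le> ln (real n) / mean_degree d n (p n)"
    using eventually_ge_at_top[of "2 * d"]
  proof eventually_elim
    case (elim n)
    then show ?case using pos[OF elim] d by (intro divide_nonneg_nonneg) auto
  qed
  show "\<forall>\<^sub>F n in sequentially. ln (real n) / mean_degree d n (p n) \<le> 1 / ?\<gamma> * ?q n"
    using eventually_ge_at_top[of "2 * d"] eventually_ge_at_top[of 3]
  proof eventually_elim
    case (elim n)
    have pn: "0 < p n" "p n < 1" using p[of n] elim by auto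
    have "ln 3 \<le> ln (real n)" using elim by simp
    then have ln1: "1 \<le> ln (real n)" using ln3_gt_1 by linarith
    have "?\<gamma> * real n ^ (d - 1) \<le> real ((n - 1) choose (d - 1))"
      using d elim by (intro binomial_ge_half_power) auto
    then have "p n * (?\<gamma> * real n ^ (d - 1)) \<le> mean_degree d n (p n)"
      unfolding mean_degree_def using pn by (intro mult_left_mono) auto
    moreover have "p n * (1 - p n) * (?\<gamma> * real n ^ (d - 1)) \<le> p n * (?\<gamma> * real n ^ (d - 1))"
      using pn \<gamma> by (intro mult_right_mono) (auto simp: mult_le_cancel_left1)
    ultimately have D: "p n * (1 - p n) * (?\<gamma> * real n ^ (d - 1)) \<le> mean_degree d n (p n)" by simp
    have "ln (real n) / mean_degree d n (p n) \<le> ln (real n) ^ 4 / (p n * (1 - p n) * (?\<gamma> * real n ^ (d - 1)))"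
      using ln1 self_le_power[of "ln (real n)" 4] pn \<gamma> elim D
      by (intro frac_le) (auto intro!: mult_pos_pos)
    also have "\<dots> = 1 / ?\<gamma> * ?q n" by simp
    finally show ?case .
  qed
qed

text \<open>
  If \<open>D\<close> dominates \<open>ln n\<close>, then \<open>exp (- (a * D))\<close> is eventually below \<open>1 / n\<^sup>2\<close>. Every failure
  probability is bounded in terms of such expressions.
\<close>

lemma exp_mean_degree_tendsto_0:
  fixes D :: "nat \<Rightarrow> real"
  assumes D: "\<forall>\<^sub>F n in sequentially. 0 < D n" "(\<lambda>n. ln (real n) / D n) \<longlonglongrightarrow> 0" and a: "0 < a"
  shows "(\<lambda>n. real n * exp (- (a * D n))) \<longlonglongrightarrow> 0"
proof (rule tendsto_sandwich[OF _ _ tendsto_const lim_inverse_n])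
  have "\<forall>\<^sub>F n in sequentially. ln (real n) / D n < a / 2"
    using order_tendstoD(2)[OF D(2), of "a / 2"] a by simp
  with D(1) show "\<forall>\<^sub>F n in sequentially. real n * exp (- (a * D n)) \<le> inverse (real n)"
    using eventually_gt_at_top[of 0]
  proof eventually_elim
    case (elim n)
    then have "2 * ln (real n) \<le> a * D n" by (simp add: pos_divide_less_eq)
    then have "exp (- (a * D n)) \<le> exp (- (2 * ln (real n)))" by simp
    also have "\<dots> = inverse (real n * real n)"
    proof -
      have "exp (2 * ln (real n)) = real n * real n" using elim by (simp only: mult_2 exp_add) simp
      then show ?thesis by (simp add: exp_minus)
    qed
    finally show ?case using elim by (simp add: field_simps)
  qed
qed auto

text \<open>
  The numerical choices: deviations of relative size \<open>e / 16\<close> in the degree of \<open>j\<close> and in the number of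
  edges, together with a relative error \<open>e / 4\<close> from the energy, stay within \<open>\<epsilon>\<close>.
\<close>

lemma regular_bounds_le:
  fixes \<epsilon> :: real
  assumes e: "0 < e" "e \<le> 1" "e \<le> \<epsilon>" and n: "4 \<le> e * real n"
  shows "(1 - \<epsilon>) * real n \<le> (1 - e / 16) / (1 + e / 16) * real n - 2"
    and "(1 + e / 16) / (1 - e / 16) * real n * (1 + e / 4) \<le> (1 + \<epsilon>) * real n"
proof -
  have "1 - e / 2 \<le> (1 - e / 16) / (1 + e / 16)"
  proof -
    have "(1 - e / 2) * (1 + e / 16) \<le> 1 - e / 16"
      using e by (simp add: algebra_simps)
    then show ?thesis using e by (simp add: pos_le_divide_eq)
  qed
  then have "(1 - e / 2) * real n - e * real n / 2 \<le> (1 - e / 16) / (1 + e / 16) * real n - 2"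
    using n by (intro diff_mono mult_right_mono) auto
  moreover have "(1 - \<epsilon>) * real n \<le> (1 - e) * real n" using e by (intro mult_right_mono) auto
  moreover have "(1 - e) * real n = (1 - e / 2) * real n - e * real n / 2" by (simp add: algebra_simps)
  ultimately show "(1 - \<epsilon>) * real n \<le> (1 - e / 16) / (1 + e / 16) * real n - 2" by linarith
  have ee: "e * e \<le> e" using e mult_left_le by auto
  have "(1 + e / 16) / (1 - e / 16) \<le> 1 + e / 4"
  proof -
    have "(1 + e / 4) * (1 - e / 16) = 1 + 3 * e / 16 - e * e / 64" by (simp add: field_simps)
    then have "1 + e / 16 \<le> (1 + e / 4) * (1 - e / 16)" using e ee by linarith
    then show ?thesis using e by (simp add: pos_divide_le_eq)
  qed
  then have "(1 + e / 16) / (1 - e / 16) * real n * (1 + e / 4) \<le> (1 + e / 4) * real n * (1 + e / 4)"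
    using e by (intro mult_right_mono) auto
  also have "\<dots> = (1 + e / 4) * (1 + e / 4) * real n" by simp
  also have "\<dots> \<le> (1 + \<epsilon>) * real n"
  proof (rule mult_right_mono)
    have "(1 + e / 4) * (1 + e / 4) = 1 + e / 2 + e * e / 16" by (simp add: field_simps)
    then show "(1 + e / 4) * (1 + e / 4) \<le> 1 + \<epsilon>" using e ee by linarith
  qed simp
  finally show "(1 + e / 16) / (1 - e / 16) * real n * (1 + e / 4) \<le> (1 + \<epsilon>) * real n" .
qed

theorem theorem3:
  fixes d :: nat and p :: "nat \<Rightarrow> real" and \<epsilon> :: real and j :: "nat \<Rightarrow> nat"
  assumes "d \<ge> 2"
    and "\<And>n. n \<ge> 1 \<Longrightarrow> 0 < p n \<and> p n < 1"
    and "(\<lambda>n. ((ln (real n)) ^ 4 / real n ^ (d - 1)) / (p n * (1 - p n))) \<longlonglongrightarrow> 0"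
    and "\<And>n. n \<ge> 1 \<Longrightarrow> j n \<in> {1..n}"
    and "\<epsilon> > 0"
  shows "(\<lambda>n. \<P>(E in random_hypergraph d n (p n).
              ennreal ((1 - \<epsilon>) * real n) \<le> average_target_hitting_time d n E (j n) \<and>
              average_target_hitting_time d n E (j n) \<le> ennreal ((1 + \<epsilon>) * real n)
            \<bar> connected_hypergraph n E)) \<longlonglongrightarrow> 1"
proof -
  note d = assms(1) and p = assms(2) and j = assms(4)
  define e where "e = min \<epsilon> 1"
  have e: "0 < e" "e \<le> 1" "e \<le> \<epsilon>" using assms(5) by (auto simp: e_def)
  define \<gamma> where "\<gamma> = crossing_ratio d"
  have \<gamma>: "0 < \<gamma>" unfolding \<gamma>_def using d by (rule crossing_ratio_pos)
  have d1: "0 < real (d - 1)" using d by simp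
  \<comment> \<open>With \<open>\<eta> = e / 16\<close>, the codegree threshold \<open>\<delta>\<close> is chosen so that the energy term contributes the
    relative error \<open>e / 4\<close>.\<close>
  define r where "r = real (d - 1) * \<gamma>"
  have r: "0 < r" unfolding r_def using d1 \<gamma> by (rule mult_pos_pos)
  define \<delta> where "\<delta> = e / 4 * gap_bound d * r / 2"
  have \<delta>: "0 < \<delta>" "2 * \<delta> / (real (d - 1) * \<gamma>) / gap_bound d = e / 4"
    using e r gap_bound_pos[OF d] unfolding r_def[symmetric] by (auto simp: \<delta>_def)
  define D where "D n = mean_degree d n (p n)" for n
  have D_pos: "\<forall>\<^sub>F n in sequentially. 0 < D n"
    using eventually_ge_at_top[of "2 * d"]
  proof eventually_elim
    case (elim n)
    then show ?case using d p[of n] unfolding D_def by (intro mean_degree_pos) auto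
  qed
  have lim: "(\<lambda>n. real n * exp (- (a * D n))) \<longlonglongrightarrow> 0" if "0 < a" for a
    using D_pos ln_over_mean_degree_tendsto_0[OF d p assms(3)] that
    unfolding D_def by (rule exp_mean_degree_tendsto_0)
  have lim': "(\<lambda>n. exp (- (a * D n))) \<longlonglongrightarrow> 0" if "0 < a" for a
  proof (rule tendsto_sandwich[OF _ _ tendsto_const lim[OF that]])
    show "\<forall>\<^sub>F n in sequentially. exp (- (a * D n)) \<le> real n * exp (- (a * D n))"
      using eventually_ge_at_top[of 1] by eventually_elim simp
  qed simp
  define B where "B n = exp (real n * exp (- (\<gamma> / 16 * D n))) - 1 + real n * exp (- (1 / 4 * D n))
      + 4 * exp (- ((e / 16)\<^sup>2 / 4 * D n)) + real n * exp (- (\<delta> / 2 * D n))" for n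
  have "B \<longlonglongrightarrow> exp 0 - 1 + 0 + 4 * 0 + 0"
    unfolding B_def[abs_def] using \<gamma> e \<delta>
    by (intro tendsto_add tendsto_diff tendsto_mult tendsto_const tendsto_exp lim lim') auto
  then have "(\<lambda>n. 1 - B n) \<longlonglongrightarrow> 1 - 0" by (intro tendsto_diff tendsto_const) simp
  then have lower: "(\<lambda>n. 1 - B n) \<longlonglongrightarrow> 1" by simp
  show ?thesis
  proof (rule tendsto_sandwich[OF _ _ lower tendsto_const])
    have ev: "\<forall>\<^sub>F n in sequentially. 4 / e \<le> real n \<and> 4 * real (d - 1) / \<delta> + 1 \<le> real n"
      by (intro eventually_conj) real_asymp+
    show "\<forall>\<^sub>F n in sequentially. 1 - B n \<le> \<P>(E in random_hypergraph d n (p n).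
              ennreal ((1 - \<epsilon>) * real n) \<le> average_target_hitting_time d n E (j n) \<and>
              average_target_hitting_time d n E (j n) \<le> ennreal ((1 + \<epsilon>) * real n)
            \<bar> connected_hypergraph n E)"
      using ev eventually_ge_at_top[of "2 * d"]
    proof eventually_elim
      case (elim n)
      have n: "2 * d \<le> n" "1 \<le> n" "2 \<le> n" "4 \<le> e * real n" "4 * real (d - 1) \<le> \<delta> * real (n - 1)"
        using elim d e \<delta>(1) by (auto simp: field_simps of_nat_diff)
      have pn: "0 < p n" "p n < 1" using p n by auto
      let ?G = "{E. E \<subseteq> hyperedges d n \<and> regular d n (D n) (j n) (e / 16) \<delta> E}"
      have "1 - B n \<le> measure_pmf.prob (random_hypergraph d n (p n)) ?G"
        using prob_regular_ge[OF pn d n(1) j[OF n(2)] _ _ n(5), of "e / 16"] e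
        by (simp add: B_def D_def \<gamma>_def mult_ac)
      also have "\<dots> \<le> \<P>(E in random_hypergraph d n (p n).
              ennreal ((1 - \<epsilon>) * real n) \<le> average_target_hitting_time d n E (j n) \<and>
              average_target_hitting_time d n E (j n) \<le> ennreal ((1 + \<epsilon>) * real n)
            \<bar> connected_hypergraph n E)"
      proof (rule cond_prob_ge_prob)
        fix E assume "E \<in> ?G"
        then have E: "E \<subseteq> hyperedges d n" "regular d n (D n) (j n) (e / 16) \<delta> E" by auto
        have "0 < D n" unfolding D_def using pn d n by (intro mean_degree_pos) auto
        note R = regular_implies[OF E(1) d n(3) j[OF n(2)] this _ _ less_imp_le[OF \<delta>(1)] E(2)]
        note b = regular_bounds_le[OF e n(4)]
        have "average_target_hitting_time d n E (j n) \<le> ennreal ((1 + e / 16) / (1 - e / 16) * real n * (1 + e / 4))"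
          using R(3)[folded \<gamma>_def, unfolded \<delta>(2)] e by simp
        also have "\<dots> \<le> ennreal ((1 + \<epsilon>) * real n)" by (intro ennreal_leI b)
        finally have "average_target_hitting_time d n E (j n) \<le> ennreal ((1 + \<epsilon>) * real n)" .
        moreover have "ennreal ((1 - \<epsilon>) * real n) \<le> average_target_hitting_time d n E (j n)"
          using e by (intro order.trans[OF ennreal_leI[OF b(1)] R(2)]) auto
        ultimately show "(ennreal ((1 - \<epsilon>) * real n) \<le> average_target_hitting_time d n E (j n) \<and>
              average_target_hitting_time d n E (j n) \<le> ennreal ((1 + \<epsilon>) * real n)) \<and> connected_hypergraph n E"
          using R(1) e by auto
      qed
      finally show ?case .
    qed
  qed (auto intro!: always_eventually cond_prob_le_1)
qed

end
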